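(* For all integers $\ell \ge 3$, $\tilde{r}(P_4, P_{\ell+1}) = \lceil (7\ell+2)/5 \rceil$.
   Context: $P_n$ denotes a path on $n$ vertices. For graphs $G_1,G_2$, the $(G_1,G_2)$-online Ramsey game is played by Builder and Painter on an infinite set of vertices, initially with no edges. In each round Builder draws one edge between two currently nonadjacent vertices, and Painter immediately colors it red or blue. Builder wins once the colored graph contains a red copy of $G_1$ or a blue copy of $G_2$. The online Ramsey number $\tilde{r}(G_1,G_2)$ is the smallest number $N$ such that Builder has a strategy guaranteeing a win within $N$ rounds against every strategy of Painter. *)

theory Defs
  imports Complex_Main "HOL-Library.Extended_Nat"
begin

text \<open>A graph is given by its vertex set and its set of edges, the latter being two-element sets.\<close>

type_synonym 'a graph = "'a set \<times> 'a set set"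

definition path_graph :: "nat \<Rightarrow> nat graph" where
  "path_graph n = ({..<n}, {{i, Suc i} |i. Suc i < n})"

definition contains_copy :: "'v set set \<Rightarrow> 'a graph \<Rightarrow> bool" where
  "contains_copy H G \<longleftrightarrow>
     (\<exists>f. inj_on f (fst G) \<and> (\<forall>e\<in>snd G. f ` e \<in> H))"

datatype colour = Red | Blue

text \<open>The board is the infinite vertex set of all natural numbers. A history lists the edges drawn
  so far in order, each with the colour it received.\<close>

type_synonym edge = "nat set"
type_synonym history = "(edge \<times> colour) list"
type_synonym builder = "history \<Rightarrow> edge"
type_synonym painter = "history \<Rightarrow> edge \<Rightarrow> colour"

definition edges_of_colour :: "colour \<Rightarrow> history \<Rightarrow> edge set" where
  "edges_of_colour c h = {e. (e, c) \<in> set h}"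

definition legal_move :: "history \<Rightarrow> edge \<Rightarrow> bool" where
  "legal_move h e \<longleftrightarrow> card e = 2 \<and> e \<notin> fst ` set h"

text \<open>Legality is demanded on every list, reachable or not; this costs Builder nothing, because an
  undrawn edge always exists.\<close>

definition legal_builder :: "builder \<Rightarrow> bool" where
  "legal_builder b \<longleftrightarrow> (\<forall>h. legal_move h (b h))"

fun play :: "builder \<Rightarrow> painter \<Rightarrow> nat \<Rightarrow> history" where
  "play b p 0 = []"
| "play b p (Suc n) = (let h = play b p n; e = b h in h @ [(e, p h e)])"

definition builder_won :: "'a graph \<Rightarrow> 'b graph \<Rightarrow> history \<Rightarrow> bool" where
  "builder_won G1 G2 h \<longleftrightarrow>
     contains_copy (edges_of_colour Red h) G1 \<or> contains_copy (edges_of_colour Blue h) G2"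

definition builder_wins_within :: "'a graph \<Rightarrow> 'b graph \<Rightarrow> nat \<Rightarrow> bool" where
  "builder_wins_within G1 G2 N \<longleftrightarrow>
     (\<exists>b. legal_builder b \<and> (\<forall>p. \<exists>n\<le>N. builder_won G1 G2 (play b p n)))"

text \<open>The value is \<open>\<infinity>\<close> if Builder cannot force a win within any fixed number of rounds.\<close>

definition online_ramsey :: "'a graph \<Rightarrow> 'b graph \<Rightarrow> enat" where
  "online_ramsey G1 G2 = Inf (enat ` {N. builder_wins_within G1 G2 N})"

end

theory Submission imports Defs begin

text \<open>
  Write \<open>R\<close> for the number of red edges.

  Lower bound: Painter colours an edge red unless this creates a red \<open>P\<^sub>4\<close> or a red triangle, so the red graph
  stays a star forest. A vertex of the final blue path without red edges has only leaves of stars with at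
  least two edges as neighbours on that path. Giving weight 4 to these leaves and weight 2 to the other
  vertices of red edges, the total weight is at least \<open>2 (l + 1)\<close> and at most \<open>5 R\<close>.

  Upper bound: Builder only draws edges whose colour is not forced. An edge that would close a red \<open>P\<^sub>4\<close> is
  as good as blue, so Builder keeps a family of vertex-disjoint paths of blue or forced edges that contains
  every blue edge; a single path with \<open>l\<close> edges then wins after \<open>l + R\<close> rounds in total. A red edge costs
  \<open>5/2\<close> path edges, but it makes vertices to which further edges are forced; a leaf of a red \<open>P\<^sub>3\<close> can be
  joined to any vertex without red edges. Only the kinds of the path ends matter, so Builder's strategy is a
  finite table of positions, each with a bound on \<open>2 E - 5 R\<close>, where \<open>E\<close> is the total number of path edges.
\<close>

section \<open>Paths and the game\<close>

text \<open>The ratio 5 : 2 comes from the red \<open>P\<^sub>3\<close>, the only star whose weight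
  is exactly 5 per edge: its two edges let the path absorb five vertices, namely its centre, its two
  leaves and, next to the leaves, two vertices without red edges. The lower bound says
  \<open>5 R \<ge> 2 l + 2\<close>, and Builder needs \<open>5 R \<le> 2 l + 6\<close>; the least
  integer R of the first kind is the greatest of the second. Builder may thus fall behind the ideal
  rate by a small constant only, for every residue of l modulo 5 and already from l = 3 on. This is
  the obstacle to a strategy in a few rules: leftover pieces cannot be written off, and the final
  path must have exactly l edges although Painter decides how the pieces grow. Deferring forced
  edges leaves Builder room: until they are committed, one position can be completed to single paths
  of several lengths, and it suffices that one of them has the right length.\<close>

lemma contains_copy_path_iff:
  "contains_copy H (path_graph n) \<longleftrightarrow>
     (\<exists>xs. length xs = n \<and> distinct xs \<and> (\<forall>i. Suc i < n \<longrightarrow> {xs ! i, xs ! Suc i} \<in> H))"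
proof
  assume "contains_copy H (path_graph n)"
  then obtain f where f: "inj_on f {..<n}" "\<And>i. Suc i < n \<Longrightarrow> f ` {i, Suc i} \<in> H"
    unfolding contains_copy_def path_graph_def fst_conv snd_conv by blast
  have "\<forall>i. Suc i < n \<longrightarrow> {map f [0..<n] ! i, map f [0..<n] ! Suc i} \<in> H"
    using f(2) by auto
  moreover have "distinct (map f [0..<n])"
    using f(1) by (simp add: distinct_map lessThan_atLeast0)
  ultimately show "\<exists>xs. length xs = n \<and> distinct xs \<and> (\<forall>i. Suc i < n \<longrightarrow> {xs ! i, xs ! Suc i} \<in> H)"
    by (intro exI[of _ "map f [0..<n]"]) auto
next
  assume "\<exists>xs. length xs = n \<and> distinct xs \<and> (\<forall>i. Suc i < n \<longrightarrow> {xs ! i, xs ! Suc i} \<in> H)"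
  then obtain xs where xs: "length xs = n" "distinct xs" "\<And>i. Suc i < n \<Longrightarrow> {xs ! i, xs ! Suc i} \<in> H"
    by blast
  have "inj_on ((!) xs) {..<n}"
    using xs by (auto simp: inj_on_def nth_eq_iff_index_eq)
  then show "contains_copy H (path_graph n)"
    unfolding contains_copy_def path_graph_def using xs(3) by (intro exI[of _ "(!) xs"]) auto
qed

definition has_P4 :: "nat set set \<Rightarrow> bool" where
  "has_P4 H \<longleftrightarrow> (\<exists>a b c d. distinct [a, b, c, d] \<and> {a, b} \<in> H \<and> {b, c} \<in> H \<and> {c, d} \<in> H)"

lemma has_P4I: "distinct [a, b, c, d] \<Longrightarrow> {a, b} \<in> H \<Longrightarrow> {b, c} \<in> H \<Longrightarrow> {c, d} \<in> H \<Longrightarrow> has_P4 H"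
  unfolding has_P4_def by blast

lemma has_P4_mono: "has_P4 H \<Longrightarrow> H \<subseteq> H' \<Longrightarrow> has_P4 H'"
  unfolding has_P4_def by blast

lemma contains_copy_P4_iff: "contains_copy H (path_graph 4) \<longleftrightarrow> has_P4 H"
proof
  assume "contains_copy H (path_graph 4)"
  then obtain xs where xs: "length xs = 4" "distinct xs" "\<And>i. Suc i < 4 \<Longrightarrow> {xs ! i, xs ! Suc i} \<in> H"
    unfolding contains_copy_path_iff by blast
  then obtain a b c d where "xs = [a, b, c, d]"
    by (auto simp: length_Suc_conv numeral_eq_Suc)
  then show "has_P4 H"
    using xs(2) xs(3)[of 0] xs(3)[of 1] xs(3)[of 2] by (auto intro!: has_P4I[of a b c d] simp: numeral_eq_Suc)
next
  assume "has_P4 H"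
  then obtain a b c d where "distinct [a, b, c, d]" "{a, b} \<in> H" "{b, c} \<in> H" "{c, d} \<in> H"
    unfolding has_P4_def by blast
  then show "contains_copy H (path_graph 4)"
    unfolding contains_copy_path_iff
    by (intro exI[of _ "[a, b, c, d]"]) (auto simp: less_Suc_eq numeral_eq_Suc)
qed

section \<open>Legal histories\<close>

abbreviation reds :: "history \<Rightarrow> edge set" where "reds \<equiv> edges_of_colour Red"
abbreviation blues :: "history \<Rightarrow> edge set" where "blues \<equiv> edges_of_colour Blue"

lemma edges_of_colour_Nil [simp]: "edges_of_colour c [] = {}"
  by (simp add: edges_of_colour_def)

lemma edges_of_colour_snoc [simp]:
  "edges_of_colour c (h @ [(e, c')]) = (if c = c' then insert e (edges_of_colour c h) else edges_of_colour c h)"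
  by (auto simp: edges_of_colour_def)

lemma reds_Un_blues: "reds h \<union> blues h = fst ` set h"
proof -
  have "(e, Red) \<in> set h \<or> (e, Blue) \<in> set h" if "(e, c) \<in> set h" for e c
    using that by (cases c) auto
  then show ?thesis by (force simp: edges_of_colour_def)
qed

lemma finite_edges_of_colour [simp]: "finite (edges_of_colour c h)"
  by (rule finite_subset[of _ "fst ` set h"]) (force simp: edges_of_colour_def)+

definition legal_history :: "history \<Rightarrow> bool" where
  "legal_history h \<longleftrightarrow> distinct (map fst h) \<and> (\<forall>e\<in>fst ` set h. card e = 2)"

lemma legal_history_snoc [simp]:
  "legal_history (h @ [(e, c)]) \<longleftrightarrow> legal_history h \<and> legal_move h e"
  by (auto simp: legal_history_def legal_move_def)

lemma legal_history_Nil [simp]: "legal_history []"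
  by (simp add: legal_history_def)

lemma legal_history_disjoint: "legal_history h \<Longrightarrow> reds h \<inter> blues h = {}"
  unfolding legal_history_def edges_of_colour_def
  using eq_key_imp_eq_value[of h _ Red Blue] by blast

lemma legal_history_length: "legal_history h \<Longrightarrow> length h = card (reds h) + card (blues h)"
proof -
  assume h: "legal_history h"
  have "length h = card (fst ` set h)"
    using h by (metis distinct_card legal_history_def length_map set_map)
  also have "\<dots> = card (reds h) + card (blues h)"
    unfolding reds_Un_blues[symmetric] using legal_history_disjoint[OF h] by (simp add: card_Un_disjoint)
  finally show ?thesis .
qed

lemma legal_history_card: "legal_history h \<Longrightarrow> e \<in> edges_of_colour c h \<Longrightarrow> card e = 2"
  unfolding legal_history_def edges_of_colour_def by (metis fst_conv image_eqI mem_Collect_eq)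

lemma legal_history_no_loop: "legal_history h \<Longrightarrow> {x, y} \<in> edges_of_colour c h \<Longrightarrow> x \<noteq> y"
  using legal_history_card[of h "{x, y}" c] by auto

lemma exists_fresh_vertex:
  assumes "legal_history h" "finite A"
  obtains v where "v \<notin> A" "\<And>e. e \<in> fst ` set h \<Longrightarrow> v \<notin> e"
proof -
  have "finite e" if "e \<in> fst ` set h" for e
    using assms(1) that unfolding legal_history_def by (metis card.infinite zero_neq_numeral)
  then have "finite (A \<union> \<Union>(fst ` set h))"
    using assms(2) by blast
  then obtain v where "v \<notin> A \<union> \<Union>(fst ` set h)"
    using ex_new_if_finite infinite_UNIV_nat by blast
  then show thesis using that by blast
qed

text \<open>A game tree in place of a strategy function: Builder's moves can be exhibited position
  by position, and both colours are followed at each move. The limit \<open>N\<close> is checked at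
  the leaves; \<open>wins_length\<close> extends it to all positions, since every one has a leaf
  below it.\<close>

inductive wins :: "'a graph \<Rightarrow> 'b graph \<Rightarrow> nat \<Rightarrow> history \<Rightarrow> bool" for G1 G2 N where
  won: "builder_won G1 G2 h \<Longrightarrow> length h \<le> N \<Longrightarrow> wins G1 G2 N h"
| move: "legal_move h e \<Longrightarrow> (\<And>c. wins G1 G2 N (h @ [(e, c)])) \<Longrightarrow> wins G1 G2 N h"

lemma wins_length: "wins G1 G2 N h \<Longrightarrow> length h \<le> N"
  by (induction rule: wins.induct) (auto dest: Suc_leD)

lemma exists_legal_move: "\<exists>e. legal_move h e"
proof -
  have "inj (\<lambda>n::nat. {0, Suc n})" by (auto simp: inj_def doubleton_eq_iff)
  then have "infinite (range (\<lambda>n::nat. {0, Suc n}))"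
    using finite_imageD infinite_UNIV_nat by blast
  then obtain n where "{0, Suc n} \<notin> fst ` set h"
    by (metis (no_types, lifting) List.finite_set finite_imageI finite_subset image_subsetI)
  then show ?thesis unfolding legal_move_def by (intro exI[of _ "{0, Suc n}"]) auto
qed

lemma length_play [simp]: "length (play b p n) = n"
  by (induction n) (auto simp: Let_def)

text \<open>The strategy draws any edge that stays in \<open>wins\<close>. If Painter survived
  \<open>N\<close> rounds, the play would still be in \<open>wins\<close> after \<open>Suc N\<close>
  rounds, against \<open>wins_length\<close>.\<close>

lemma wins_imp_builder_wins_within:
  assumes "wins G1 G2 N []"
  shows "builder_wins_within G1 G2 N"
proof -
  define good where "good h e \<longleftrightarrow> legal_move h e \<and> (\<forall>c. wins G1 G2 N (h @ [(e, c)]))" for h e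
  \<comment> \<open>\<open>legal_builder\<close> concerns all lists, so a legal edge is supplied
    outside the winning positions too.\<close>
  define b where "b h = (if \<exists>e. good h e then SOME e. good h e else SOME e. legal_move h e)" for h
  have good_b: "good h (b h)" if "wins G1 G2 N h" "\<not> builder_won G1 G2 h" for h
  proof -
    have "\<exists>e. good h e"
      using that by (cases rule: wins.cases) (auto simp: good_def)
    then show ?thesis unfolding b_def by (simp add: someI_ex)
  qed
  have "legal_builder b"
    unfolding legal_builder_def b_def using exists_legal_move by (auto simp: good_def intro: someI2_ex)
  moreover have "\<exists>n\<le>N. builder_won G1 G2 (play b p n)" for p
  proof (rule ccontr)
    assume never: "\<not> ?thesis"
    have "wins G1 G2 N (play b p n)" if "n \<le> Suc N" for n
      using that
    proof (induction n)
      case (Suc n)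
      then have "good (play b p n) (b (play b p n))"
        using never by (intro good_b) auto
      then show ?case by (simp add: good_def Let_def)
    qed (simp add: assms)
    from wins_length[OF this[of "Suc N"]] show False by (simp del: play.simps)
  qed
  ultimately show ?thesis unfolding builder_wins_within_def by blast
qed

section \<open>Edge sets of paths given as lists\<close>

fun path_edges :: "'v list \<Rightarrow> 'v set set" where
  "path_edges (x # y # xs) = insert {x, y} (path_edges (y # xs))"
| "path_edges _ = {}"

lemma finite_path_edges [simp]: "finite (path_edges p)"
  by (induction p rule: path_edges.induct) auto

lemma path_edges_subset: "e \<in> path_edges p \<Longrightarrow> e \<subseteq> set p"
  by (induction p rule: path_edges.induct) auto

lemma path_edges_append:
  "path_edges (p @ q) = path_edges p \<union> path_edges q \<union> (if p = [] \<or> q = [] then {} else {{last p, hd q}})"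
proof (induction p rule: path_edges.induct)
  case ("2_2" v)
  then show ?case by (cases q) auto
qed auto

lemma path_edges_rev [simp]: "path_edges (rev p) = path_edges p"
proof (induction p)
  case (Cons x p)
  show ?case
  proof (cases p)
    case (Cons y ys)
    have "path_edges (rev p @ [x]) = insert {y, x} (path_edges (rev p))"
      by (subst path_edges_append) (simp add: Cons)
    also have "\<dots> = insert {x, y} (path_edges p)"
      unfolding Cons.IH by (simp add: insert_commute)
    finally show ?thesis using Cons by simp
  qed simp
qed simp

lemma card_path_edges: "distinct p \<Longrightarrow> card (path_edges p) = length p - 1"
proof (induction p rule: path_edges.induct)
  case (1 x y xs)
  then have "{x, y} \<notin> path_edges (y # xs)"
    using path_edges_subset by fastforce
  then show ?case using 1 by simp
qed auto

lemma successively_path_edges: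
  "successively P p \<Longrightarrow> e \<in> path_edges p \<Longrightarrow> \<exists>x y. e = {x, y} \<and> P x y"
  by (induction p rule: path_edges.induct) (auto simp: successively_Cons)

lemma path_edges_nth: "Suc i < length p \<Longrightarrow> {p ! i, p ! Suc i} \<in> path_edges p"
proof (induction p arbitrary: i rule: path_edges.induct)
  case (1 x y xs)
  then show ?case by (cases i) (auto simp del: nth_Cons_Suc simp: nth_Cons_Suc[of x "y # xs"])
qed auto

section \<open>The lower bound\<close>

lemma path_edges_conv_nth: "path_edges p = {{p ! i, p ! Suc i} |i. Suc i < length p}"
proof
  show "path_edges p \<subseteq> {{p ! i, p ! Suc i} |i. Suc i < length p}"
  proof (induction p rule: path_edges.induct)
    case (1 x y xs)
    have "\<exists>j. e = {(x # y # xs) ! j, (x # y # xs) ! Suc j} \<and> Suc j < length (x # y # xs)"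
      if e: "e \<in> path_edges (y # xs)" for e
    proof -
      obtain i where "e = {(y # xs) ! i, (y # xs) ! Suc i}" "Suc i < length (y # xs)" using 1 e by blast
      then show ?thesis by (intro exI[of _ "Suc i"]) simp
    qed
    moreover have "\<exists>j. {x, y} = {(x # y # xs) ! j, (x # y # xs) ! Suc j} \<and> Suc j < length (x # y # xs)"
      by (intro exI[of _ 0]) simp
    ultimately show ?case by auto
  qed auto
qed (auto simp: path_edges_nth)

section \<open>Star forests and their weight\<close>

definition degree :: "'v set set \<Rightarrow> 'v \<Rightarrow> nat" where
  "degree H v = card {e \<in> H. v \<in> e}"

text \<open>The ends of an isolated red edge are excluded: an edge from a vertex without red edges
  to such an end closes only a red \<open>P\<^sub>3\<close>, so it is not forced.\<close>

definition star_leaf :: "'v set set \<Rightarrow> 'v \<Rightarrow> bool" where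
  "star_leaf H v \<longleftrightarrow> degree H v = 1 \<and> (\<exists>c. {v, c} \<in> H \<and> degree H c \<ge> 2)"

definition has_triangle :: "'v set set \<Rightarrow> bool" where
  "has_triangle H \<longleftrightarrow> (\<exists>a b c. distinct [a, b, c] \<and> {a, b} \<in> H \<and> {b, c} \<in> H \<and> {a, c} \<in> H)"

lemma has_triangleI: "distinct [a, b, c] \<Longrightarrow> {a, b} \<in> H \<Longrightarrow> {b, c} \<in> H \<Longrightarrow> {a, c} \<in> H \<Longrightarrow> has_triangle H"
  unfolding has_triangle_def by blast

lemma has_triangle_mono: "has_triangle H \<Longrightarrow> H \<subseteq> H' \<Longrightarrow> has_triangle H'"
  unfolding has_triangle_def by blast

lemma has_triangleE:
  assumes "has_triangle H"
  obtains a b c where "distinct [a, b, c]" "{a, b} \<in> H" "{b, c} \<in> H" "{a, c} \<in> H"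
  using assms unfolding has_triangle_def by blast

lemma has_P4E:
  assumes "has_P4 H"
  obtains a b c d where "distinct [a, b, c, d]" "{a, b} \<in> H" "{b, c} \<in> H" "{c, d} \<in> H"
  using assms unfolding has_P4_def by blast

text \<open>Forbidding both subgraphs leaves only stars as components, and the invariant reads like
  Painter's rule, so that a red move preserves it by definition.\<close>

definition star_forest :: "nat set set \<Rightarrow> bool" where
  "star_forest H \<longleftrightarrow> finite H \<and> (\<forall>e\<in>H. card e = 2) \<and> \<not> has_P4 H \<and> \<not> has_triangle H"

lemma degree_ge_2D:
  assumes "\<forall>e\<in>H. card e = 2" "degree H v \<ge> 2" "{v, w} \<in> H"
  obtains x where "{v, x} \<in> H" "x \<noteq> w" "x \<noteq> v"
proof -
  have "\<exists>e\<in>{e \<in> H. v \<in> e}. e \<noteq> {v, w}"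
  proof (rule ccontr)
    assume "\<not> ?thesis"
    then have "{e \<in> H. v \<in> e} \<subseteq> {{v, w}}" by blast
    then have "card {e \<in> H. v \<in> e} \<le> 1" using card_mono[of "{{v, w}}"] by fastforce
    then show False using assms(2) by (simp add: degree_def)
  qed
  then obtain e where e: "e \<in> H" "v \<in> e" "e \<noteq> {v, w}" by blast
  then obtain x where "e = {v, x}" "x \<noteq> v" using assms(1) by (auto simp: card_2_iff doubleton_eq_iff)
  then show thesis using e that[of x] by auto
qed

lemma degree_ge_2I:
  assumes "finite H" "{v, x} \<in> H" "{v, y} \<in> H" "x \<noteq> y"
  shows "degree H v \<ge> 2"
proof -
  have "{v, x} \<noteq> {v, y}" using assms(4) by (auto simp: doubleton_eq_iff)
  then have "card {{v, x}, {v, y}} = 2" by simp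
  moreover have "card {{v, x}, {v, y}} \<le> card {e \<in> H. v \<in> e}" using assms by (intro card_mono) auto
  ultimately show ?thesis by (simp add: degree_def)
qed

lemma degree_pos: "finite H \<Longrightarrow> e \<in> H \<Longrightarrow> v \<in> e \<Longrightarrow> degree H v \<ge> 1"
proof -
  assume "finite H" "e \<in> H" "v \<in> e"
  then have "card {e} \<le> card {e \<in> H. v \<in> e}" by (intro card_mono) auto
  then show ?thesis by (simp add: degree_def)
qed

text \<open>If both ends had another neighbour, these two neighbours would close a triangle when
  equal and a \<open>P\<^sub>4\<close> when distinct. Star components enter the proof only in this
  form, edge by edge.\<close>

lemma star_forest_edge:
  assumes "star_forest H" "{a, b} \<in> H"
  shows "degree H a = 1 \<or> degree H b = 1"
proof (rule ccontr)
  assume neg: "\<not> ?thesis"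
  have H: "finite H" "\<forall>e\<in>H. card e = 2" "\<not> has_P4 H" "\<not> has_triangle H"
    using assms(1) by (auto simp: star_forest_def)
  have "degree H a \<ge> 1" "degree H b \<ge> 1"
    using degree_pos[OF H(1) assms(2)] by auto
  then have ge: "degree H a \<ge> 2" "degree H b \<ge> 2" using neg by auto
  obtain x where x: "{a, x} \<in> H" "x \<noteq> b" "x \<noteq> a"
    using degree_ge_2D[OF H(2) ge(1) assms(2)] .
  have ba: "{b, a} \<in> H" using assms(2) by (simp add: insert_commute)
  obtain y where y: "{b, y} \<in> H" "y \<noteq> a" "y \<noteq> b"
    using degree_ge_2D[OF H(2) ge(2) ba] .
  have "a \<noteq> b" using H(2) assms(2) by force
  show False
  proof (cases "x = y")
    case True
    then have "has_triangle H"
      unfolding has_triangle_def using x y \<open>a \<noteq> b\<close> assms(2) by (intro exI[of _ a] exI[of _ b] exI[of _ x]) auto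
    then show False using H(4) by simp
  next
    case False
    then have "has_P4 H"
      using x y \<open>a \<noteq> b\<close> assms(2) by (intro has_P4I[of x a b y]) (auto simp: insert_commute)
    then show False using H(3) by simp
  qed
qed

text \<open>Discharging: each vertex splits its weight evenly among its red edges. An edge of a star
  with k \<ge> 2 edges receives 4 + 2 / k \<le> 5, an isolated red edge 2 + 2.\<close>

lemma star_forest_weight:
  assumes "star_forest H"
  shows "(\<Sum>v\<in>\<Union>H. if star_leaf H v then 4 else 2) \<le> 5 * card H"
proof -
  \<comment> \<open>Real weights, because the share that a vertex gives to an edge is a
    quotient.\<close>
  let ?f = "\<lambda>v. if star_leaf H v then 4 else 2 :: real"
  let ?g = "\<lambda>v. ?f v / degree H v"
  have H: "finite H" "\<And>e. e \<in> H \<Longrightarrow> card e = 2"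
    using assms by (auto simp: star_forest_def)
  have "finite e" if "e \<in> H" for e using H(2)[OF that] by (metis card.infinite zero_neq_numeral)
  then have fin: "finite (\<Union>H)" using H(1) by blast
  have "?f v = (\<Sum>e\<in>{e \<in> H. v \<in> e}. ?g v)" if "v \<in> \<Union>H" for v
  proof -
    have "degree H v \<noteq> 0" using that degree_pos[OF H(1)] by fastforce
    then show ?thesis by (simp add: degree_def)
  qed
  then have "(\<Sum>v\<in>\<Union>H. ?f v) = (\<Sum>v\<in>\<Union>H. \<Sum>e\<in>{e \<in> H. v \<in> e}. ?g v)"
    by (rule sum.cong[OF refl])
  also have "\<dots> = (\<Sum>e\<in>H. \<Sum>v\<in>{v \<in> \<Union>H. v \<in> e}. ?g v)"
    by (rule sum.swap_restrict[OF fin H(1)])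
  also have "\<dots> \<le> (\<Sum>e\<in>H. 5)"
  proof (rule sum_mono)
    fix e assume e: "e \<in> H"
    obtain a b where ab: "e = {a, b}" "a \<noteq> b" "degree H a = 1"
    proof -
      obtain a b where "e = {a, b}" "a \<noteq> b" using H(2)[OF e] by (auto simp: card_2_iff)
      then show thesis using star_forest_edge[OF assms, of a b] e that[of a b] that[of b a]
        by (auto simp: insert_commute)
    qed
    have "{v \<in> \<Union>H. v \<in> e} = {a, b}" using e ab(1) by auto
    then have "(\<Sum>v\<in>{v \<in> \<Union>H. v \<in> e}. ?g v) = ?g a + ?g b" using ab(2) by simp
    also have "\<dots> \<le> 5"
    proof (cases "degree H b \<ge> 2")
      case True
      then have "\<not> star_leaf H b" by (simp add: star_leaf_def)
      then show ?thesis using True ab(3) by (auto simp: field_simps)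
    next
      case False
      have "\<not> star_leaf H a"
      proof
        assume "star_leaf H a"
        then obtain c where c: "{a, c} \<in> H" "degree H c \<ge> 2" by (auto simp: star_leaf_def)
        then have "c \<noteq> b" using False by auto
        then show False using degree_ge_2I[OF H(1) c(1), of b] e ab(1,3) by simp
      qed
      moreover have "\<not> star_leaf H b"
      proof
        assume "star_leaf H b"
        then obtain c where c: "{b, c} \<in> H" "degree H c \<ge> 2" "degree H b = 1" by (auto simp: star_leaf_def)
        then have "c \<noteq> a" using ab(3) by auto
        then show False using degree_ge_2I[OF H(1) c(1), of a] e ab(1) c(3) by (simp add: insert_commute)
      qed
      moreover have "degree H b = 1" using False degree_pos[OF H(1) e, of b] ab(1) by simp
      ultimately show ?thesis using ab(3) by simp
    qed
    finally show "(\<Sum>v\<in>{v \<in> \<Union>H. v \<in> e}. ?g v) \<le> 5" .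
  qed
  also have "\<dots> = real (5 * card H)" by simp
  finally have "real (\<Sum>v\<in>\<Union>H. if star_leaf H v then 4 else 2) \<le> real (5 * card H)"
    by (simp add: if_distrib cong: if_cong)
  then show ?thesis by (simp only: of_nat_le_iff)
qed

text \<open>In the enlarged graph the only edge at \<open>u\<close> leads to \<open>v\<close>. So
  \<open>u\<close> is on no triangle and can only be an end of the \<open>P\<^sub>4\<close>; its
  other three vertices form a red path that starts at \<open>v\<close>, and the second of them is a
  star centre.\<close>

lemma star_forest_isolated_neighbour:
  assumes "star_forest H" "u \<notin> \<Union>H" "has_P4 (insert {u, v} H) \<or> has_triangle (insert {u, v} H)"
  shows "star_leaf H v"
proof -
  have H: "finite H" "\<forall>e\<in>H. card e = 2" "\<not> has_P4 H" "\<not> has_triangle H"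
    using assms(1) by (auto simp: star_forest_def)
  have at_u: "y = v" if "{u, y} \<in> insert {u, v} H" for y
    using that assms(2) by (auto simp: doubleton_eq_iff)
  have off_u: "{x, y} \<in> H" if "{x, y} \<in> insert {u, v} H" "x \<noteq> u" "y \<noteq> u" for x y
    using that by (auto simp: doubleton_eq_iff)
  have leaf: "star_leaf H v" if cd: "{v, c} \<in> H" "{c, d} \<in> H" "d \<noteq> v" for c d
  proof -
    have "degree H c \<ge> 2"
      using degree_ge_2I[OF H(1), of c v d] cd by (simp add: insert_commute)
    moreover have "degree H v = 1"
      using star_forest_edge[OF assms(1) cd(1)] calculation by auto
    ultimately show ?thesis using cd(1) by (auto simp: star_leaf_def)
  qed
  from assms(3) show ?thesis
  proof
    assume "has_P4 (insert {u, v} H)"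
    then obtain a b c d where P: "distinct [a, b, c, d]" "{a, b} \<in> insert {u, v} H" "{b, c} \<in> insert {u, v} H"
      "{c, d} \<in> insert {u, v} H"
      by (rule has_P4E)
    have sym: "{b, a} \<in> insert {u, v} H" "{c, b} \<in> insert {u, v} H" "{d, c} \<in> insert {u, v} H"
      using P(2-4) by (simp_all add: insert_commute)
    have "u \<in> {a, b, c, d}"
    proof (rule ccontr)
      assume "u \<notin> {a, b, c, d}"
      then have "{a, b} \<in> H" "{b, c} \<in> H" "{c, d} \<in> H"
        using off_u[OF P(2)] off_u[OF P(3)] off_u[OF P(4)] by simp_all
      then show False using H(3) has_P4I[OF P(1)] by simp
    qed
    then consider "a = u" | "b = u" | "c = u" | "d = u" by blast
    then show ?thesis
    proof cases
      case 1
      then have "b = v" "{b, c} \<in> H" "{c, d} \<in> H"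
        using P(1,2) at_u[of b] off_u[OF P(3)] off_u[OF P(4)] by simp_all
      then show ?thesis using leaf[of c d] P(1) by simp
    next
      case 2
      then have "a = v" "c = v" using P(3) sym(1) at_u[of a] at_u[of c] by simp_all
      then show ?thesis using P(1) by simp
    next
      case 3
      then have "b = v" "d = v" using P(4) sym(2) at_u[of b] at_u[of d] by simp_all
      then show ?thesis using P(1) by simp
    next
      case 4
      then have "c = v" using sym(3) at_u[of c] by simp
      moreover have "{b, a} \<in> H" "{c, b} \<in> H" using 4 P(1) off_u[OF sym(1)] off_u[OF sym(2)] by simp_all
      ultimately show ?thesis using leaf[of b a] P(1) by simp
    qed
  next
    assume "has_triangle (insert {u, v} H)"
    then obtain a b c where T: "distinct [a, b, c]" "{a, b} \<in> insert {u, v} H" "{b, c} \<in> insert {u, v} H"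
      "{a, c} \<in> insert {u, v} H"
      by (rule has_triangleE)
    have sym: "{b, a} \<in> insert {u, v} H" "{c, b} \<in> insert {u, v} H" "{c, a} \<in> insert {u, v} H"
      using T(2-4) by (simp_all add: insert_commute)
    have "u \<in> {a, b, c}"
    proof (rule ccontr)
      assume "u \<notin> {a, b, c}"
      then have "{a, b} \<in> H" "{b, c} \<in> H" "{a, c} \<in> H"
        using off_u[OF T(2)] off_u[OF T(3)] off_u[OF T(4)] by simp_all
      then show False using H(4) has_triangleI[OF T(1)] by simp
    qed
    then consider "a = u" | "b = u" | "c = u" by blast
    then have False
    proof cases
      case 1
      then show False using T at_u[of b] at_u[of c] by simp
    next
      case 2
      then show False using T sym at_u[of a] at_u[of c] by simp
    next
      case 3
      then show False using T sym at_u[of a] at_u[of b] by simp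
    qed
    then show ?thesis ..
  qed
qed

text \<open>Every vertex of \<open>I\<close> is sent to its neighbour in the direction of position
  \<open>s\<close>. The image lies in \<open>A\<close>, hence is not at \<open>s\<close>; so images
  from different sides of \<open>s\<close> never meet, and the map is injective.\<close>

lemma card_isolated_le:
  assumes xs: "distinct xs" and I: "I \<subseteq> set xs"
    and nb: "\<And>i. Suc i < length xs \<Longrightarrow> xs ! i \<in> I \<Longrightarrow> xs ! Suc i \<in> A"
      "\<And>i. Suc i < length xs \<Longrightarrow> xs ! Suc i \<in> I \<Longrightarrow> xs ! i \<in> A"
    and s: "s < length xs" "xs ! s \<notin> I" "xs ! s \<notin> A" and A: "A \<subseteq> set xs"
  shows "card I \<le> card A"
proof -
  define pos where "pos v = (THE i. i < length xs \<and> xs ! i = v)" for v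
  have pos: "pos (xs ! i) = i" if "i < length xs" for i
    unfolding pos_def using that xs by (auto simp: nth_eq_iff_index_eq)
  define f where "f v = (if pos v < s then xs ! Suc (pos v) else xs ! (pos v - 1))" for v
  have "pos v < length xs" "xs ! pos v = v" if "v \<in> I" for v
    using that I pos by (metis in_set_conv_nth subsetD)+
  note posI = this
  have cases: "(pos v < s \<and> Suc (pos v) < s \<and> pos (f v) = Suc (pos v) \<and> f v \<in> A) \<or>
      (s < pos v \<and> s < pos v - 1 \<and> pos (f v) = pos v - 1 \<and> f v \<in> A)" if v: "v \<in> I" for v
  proof -
    have ne: "pos v \<noteq> s" using posI[OF v] s(2) v by auto
    show ?thesis
    proof (cases "pos v < s")
      case True
      then have "f v = xs ! Suc (pos v)" "Suc (pos v) < length xs" using s(1) by (auto simp: f_def)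
      moreover from this have "f v \<in> A" using nb(1)[of "pos v"] posI[OF v] v by simp
      moreover have "Suc (pos v) \<noteq> s" using calculation s(3) by auto
      ultimately show ?thesis using True pos[of "Suc (pos v)"] by auto
    next
      case False
      then have gt: "s < pos v" using ne by simp
      then have f: "f v = xs ! (pos v - 1)" by (simp add: f_def)
      have "f v \<in> A" using nb(2)[of "pos v - 1"] posI[OF v] v gt f by simp
      moreover have "pos v - 1 \<noteq> s" using calculation s(3) f by auto
      ultimately show ?thesis using gt f posI[OF v] pos[of "pos v - 1"] by auto
    qed
  qed
  have "inj_on f I"
  proof (rule inj_onI)
    fix v w assume "v \<in> I" "w \<in> I" "f v = f w"
    then have "pos v = pos w" using cases[of v] cases[of w] by auto
    then show "v = w" using posI \<open>v \<in> I\<close> \<open>w \<in> I\<close> by metis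
  qed
  moreover have "f ` I \<subseteq> A" using cases by auto
  moreover have "finite A" using A finite_subset by auto
  ultimately show ?thesis using card_inj_on_le by blast
qed


text \<open>The surplus 2 of a star leaf pays for a vertex without red edges, so |I| \<le> |A|
  suffices. If every vertex of the path is of one of these two sorts, only |I| \<le> |A| + 1 is
  available; but then a star centre lies off the path, and its weight pays the missing 2.\<close>

lemma star_forest_path_bound:
  assumes H: "star_forest H" and xs: "distinct xs" "length xs \<ge> 2"
    and forced: "\<And>i. Suc i < length xs \<Longrightarrow>
      has_P4 (insert {xs ! i, xs ! Suc i} H) \<or> has_triangle (insert {xs ! i, xs ! Suc i} H)"
  shows "2 * length xs \<le> 5 * card H"
proof -
  define I where "I = set xs - \<Union>H"
  define A where "A = {v \<in> set xs. star_leaf H v}"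
  let ?f = "\<lambda>v. if star_leaf H v then 4 else 2 :: nat"
  have "finite e" if "e \<in> H" for e
    using H that unfolding star_forest_def by (metis card.infinite zero_neq_numeral)
  then have fin: "finite (\<Union>H)" "finite I" "finite A"
    using H by (auto simp: I_def A_def star_forest_def)
  have leafD: "v \<in> \<Union>H" "\<exists>c\<in>\<Union>H. \<not> star_leaf H c" if v: "star_leaf H v" for v
  proof -
    obtain c where c: "{v, c} \<in> H" "degree H c \<ge> 2" using v by (auto simp: star_leaf_def)
    then have "\<not> star_leaf H c" by (auto simp: star_leaf_def)
    then show "v \<in> \<Union>H" "\<exists>c\<in>\<Union>H. \<not> star_leaf H c" using c(1) by blast+
  qed
  have next_leaf: "xs ! Suc i \<in> A" if "Suc i < length xs" "xs ! i \<in> I" for i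
    using star_forest_isolated_neighbour[OF H _ forced[OF that(1)]] that by (simp add: I_def A_def)
  have prev_leaf: "xs ! i \<in> A" if "Suc i < length xs" "xs ! Suc i \<in> I" for i
    using star_forest_isolated_neighbour[OF H, of "xs ! Suc i" "xs ! i"] forced[OF that(1)] that
    by (simp add: I_def A_def insert_commute)
  have split: "card (set xs) = card I + card (set xs \<inter> \<Union>H)"
    unfolding I_def by (metis List.finite_set card_Int_Diff add.commute)
  have weight: "(\<Sum>v\<in>W. ?f v) = 2 * card W + 2 * card {v \<in> W. star_leaf H v}" if "finite W" for W
  proof -
    have "(\<Sum>v\<in>W. ?f v) = (\<Sum>v\<in>W. 2 + (if star_leaf H v then 2 else 0))" by (rule sum.cong) auto
    also have "\<dots> = (\<Sum>v\<in>W. 2) + (\<Sum>v\<in>W. if star_leaf H v then 2 else 0)" by (rule sum.distrib)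
    also have "(\<Sum>v\<in>W. if star_leaf H v then 2 else 0) = (\<Sum>v\<in>{v \<in> W. star_leaf H v}. 2)"
      by (rule sum.inter_filter[OF that, symmetric])
    finally show ?thesis by simp
  qed
  have "2 * card (set xs) \<le> (\<Sum>v\<in>\<Union>H. ?f v)"
  proof (cases "\<exists>s < length xs. xs ! s \<notin> I \<and> xs ! s \<notin> A")
    case True
    then obtain s where s: "s < length xs" "xs ! s \<notin> I" "xs ! s \<notin> A" by blast
    have "card I \<le> card A"
      by (rule card_isolated_le[OF xs(1) _ next_leaf prev_leaf s]) (auto simp: I_def A_def)
    moreover have "{v \<in> set xs \<inter> \<Union>H. star_leaf H v} = A"
      using leafD(1) by (auto simp: A_def)
    ultimately have "2 * card (set xs) \<le> (\<Sum>v\<in>set xs \<inter> \<Union>H. ?f v)"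
      using split weight[of "set xs \<inter> \<Union>H"] by simp
    also have "\<dots> \<le> (\<Sum>v\<in>\<Union>H. ?f v)" by (rule sum_mono2) (use fin in auto)
    finally show ?thesis .
  next
    case False
    then have all: "xs ! s \<in> I \<or> xs ! s \<in> A" if "s < length xs" for s using that by blast
    have "0 < length xs" "Suc 0 < length xs" using xs(2) by linarith+
    \<comment> \<open>One of the first two vertices is a star leaf, so there is a star whose centre
      can be used.\<close>
    then have "xs ! 0 \<in> A \<or> xs ! Suc 0 \<in> A" using all[of 0] next_leaf[of 0] by blast
    then obtain v where v: "star_leaf H v" by (auto simp: A_def)
    then obtain c where c: "c \<in> \<Union>H" "\<not> star_leaf H c" using leafD(2) by blast
    have "card I \<le> card A + 1"
    proof -
      let ?g = "\<lambda>i. xs ! Suc i"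
      \<comment> \<open>Passing to the next vertex on the path maps into \<open>A\<close>; the last
        vertex has no successor and accounts for the additional 1.\<close>
      have "I - {last xs} \<subseteq> (!) xs ` {i. Suc i < length xs \<and> xs ! i \<in> I}"
      proof
        fix w assume w: "w \<in> I - {last xs}"
        then obtain i where i: "i < length xs" "xs ! i = w" by (auto simp: I_def in_set_conv_nth)
        have "last xs = xs ! (length xs - 1)" using i(1) by (intro last_conv_nth) auto
        then have "i \<noteq> length xs - 1" using w i(2) by auto
        then have "Suc i < length xs" using i(1) by linarith
        then show "w \<in> (!) xs ` {i. Suc i < length xs \<and> xs ! i \<in> I}" using i(2) w by blast
      qed
      moreover have "finite {i. Suc i < length xs \<and> xs ! i \<in> I}"
        by (rule finite_subset[of _ "{..<length xs}"]) auto
      ultimately have "card (I - {last xs}) \<le> card {i. Suc i < length xs \<and> xs ! i \<in> I}"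
        using surj_card_le by blast
      also have "\<dots> \<le> card A"
      proof (rule card_inj_on_le[of ?g])
        show "inj_on ?g {i. Suc i < length xs \<and> xs ! i \<in> I}"
          using xs(1) by (auto simp: inj_on_def nth_eq_iff_index_eq)
        show "?g ` {i. Suc i < length xs \<and> xs ! i \<in> I} \<subseteq> A"
          using next_leaf by blast
      qed (rule fin(3))
      finally show ?thesis using fin(2) by (cases "last xs \<in> I") auto
    qed
    moreover have "set xs \<inter> \<Union>H = A"
    proof
      show "set xs \<inter> \<Union>H \<subseteq> A"
      proof
        fix w assume w: "w \<in> set xs \<inter> \<Union>H"
        then obtain i where "i < length xs" "w = xs ! i" by (auto simp: in_set_conv_nth)
        then show "w \<in> A" using all[of i] w by (auto simp: I_def)
      qed
    qed (use leafD(1) in \<open>auto simp: A_def\<close>)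
    ultimately have "2 * card (set xs) \<le> 4 * card A + 2" using split by simp
    also have "\<dots> = (\<Sum>v\<in>insert c A. ?f v)"
      using c(2) fin(3) by (simp add: A_def)
    also have "\<dots> \<le> (\<Sum>v\<in>\<Union>H. ?f v)"
      by (rule sum_mono2) (use fin c leafD(1) in \<open>auto simp: A_def\<close>)
    finally show ?thesis .
  qed
  also have "\<dots> \<le> 5 * card H" by (rule star_forest_weight[OF H])
  finally show ?thesis using xs(1) by (simp add: distinct_card)
qed

section \<open>Painter's strategy\<close>

definition star_painter :: painter where
  "star_painter h e =
     (if has_P4 (insert e (reds h)) \<or> has_triangle (insert e (reds h)) then Blue else Red)"

lemma star_painter_Blue_iff:
  "star_painter h e = Blue \<longleftrightarrow> has_P4 (insert e (reds h)) \<or> has_triangle (insert e (reds h))"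
  by (simp add: star_painter_def)

text \<open>For a blue edge the condition refers to the current red graph, not to the one when it
  was drawn: red paths and triangles persist. So the final position alone carries all that the
  counting needs.\<close>

lemma star_painter_play:
  assumes "legal_builder b"
  shows "legal_history (play b star_painter n) \<and> star_forest (reds (play b star_painter n)) \<and>
    (\<forall>e\<in>blues (play b star_painter n).
       has_P4 (insert e (reds (play b star_painter n))) \<or> has_triangle (insert e (reds (play b star_painter n))))"
proof (induction n)
  case 0
  show ?case by (simp add: star_forest_def has_P4_def has_triangle_def)
next
  case (Suc n)
  let ?h = "play b star_painter n"
  have legal: "legal_move ?h (b ?h)" using assms by (simp add: legal_builder_def)
  show ?case
  proof (cases "star_painter ?h (b ?h)")
    case Blue
    then have "has_P4 (insert (b ?h) (reds ?h)) \<or> has_triangle (insert (b ?h) (reds ?h))"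
      by (simp only: star_painter_Blue_iff)
    then show ?thesis using Suc legal Blue by (simp add: Let_def)
  next
    case Red
    then have "star_painter ?h (b ?h) \<noteq> Blue" by simp
    then have new: "\<not> has_P4 (insert (b ?h) (reds ?h))" "\<not> has_triangle (insert (b ?h) (reds ?h))"
      unfolding star_painter_Blue_iff by blast+
    have "star_forest (insert (b ?h) (reds ?h))"
      using new Suc legal by (simp add: star_forest_def legal_move_def)
    moreover have "has_P4 (insert e (insert (b ?h) (reds ?h))) \<or> has_triangle (insert e (insert (b ?h) (reds ?h)))"
      if "e \<in> blues ?h" for e
    proof -
      have "has_P4 (insert e (reds ?h)) \<or> has_triangle (insert e (reds ?h))" using Suc that by blast
      then show ?thesis
      proof
        assume "has_P4 (insert e (reds ?h))"
        then show ?thesis by (rule disjI1[OF has_P4_mono]) blast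
      next
        assume "has_triangle (insert e (reds ?h))"
        then show ?thesis by (rule disjI2[OF has_triangle_mono]) blast
      qed
    qed
    ultimately show ?thesis using Red Suc legal by (simp add: Let_def)
  qed
qed

lemma builder_wins_within_lower:
  assumes "builder_wins_within (path_graph 4) (path_graph (l + 1)) N" "l \<ge> 1"
  shows "l + (2 * l + 6) div 5 \<le> N"
proof -
  obtain b n where b: "legal_builder b" and n: "n \<le> N"
    and won: "builder_won (path_graph 4) (path_graph (l + 1)) (play b star_painter n)"
    using assms(1) unfolding builder_wins_within_def by blast
  let ?h = "play b star_painter n"
  have legal: "legal_history ?h" and forest: "star_forest (reds ?h)"
    and blue: "\<And>e. e \<in> blues ?h \<Longrightarrow> has_P4 (insert e (reds ?h)) \<or> has_triangle (insert e (reds ?h))"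
    using star_painter_play[OF b, of n] by blast+
  have "\<not> has_P4 (reds ?h)" using forest by (simp add: star_forest_def)
  then have "contains_copy (blues ?h) (path_graph (l + 1))"
    using won by (simp add: builder_won_def contains_copy_P4_iff)
  then obtain xs where xs: "length xs = l + 1" "distinct xs" "\<And>i. Suc i < l + 1 \<Longrightarrow> {xs ! i, xs ! Suc i} \<in> blues ?h"
    unfolding contains_copy_path_iff by blast
  \<comment> \<open>For integers this says that at least \<open>(2 * l + 6) div 5\<close> edges are
    red, which is (2 l + 2) / 5 rounded up.\<close>
  have "2 * length xs \<le> 5 * card (reds ?h)"
    using xs assms(2) blue by (intro star_forest_path_bound[OF forest]) auto
  moreover have "path_edges xs \<subseteq> blues ?h"
    unfolding path_edges_conv_nth using xs(1,3) by auto
  then have "l \<le> card (blues ?h)"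
    using card_mono[of "blues ?h" "path_edges xs"] card_path_edges[OF xs(2)] xs(1) by simp
  ultimately show ?thesis using legal_history_length[OF legal] n xs(1) by simp
qed

section \<open>Families of virtual paths\<close>

text \<open>A forced edge counts as an edge of a path before it is drawn. Its drawing can be
  postponed freely, because it stays forced while the red graph grows.\<close>

definition virtual_edge :: "history \<Rightarrow> nat \<Rightarrow> nat \<Rightarrow> bool" where
  "virtual_edge h x y \<longleftrightarrow> {x, y} \<in> blues h \<or> has_P4 (insert {x, y} (reds h))"

lemma virtual_edge_commute: "virtual_edge h x y \<longleftrightarrow> virtual_edge h y x"
  unfolding virtual_edge_def by (simp add: insert_commute)

lemma virtual_edge_snoc: "virtual_edge h x y \<Longrightarrow> virtual_edge (h @ [(e, c)]) x y"
proof -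
  have "has_P4 (insert {x, y} (reds h)) \<Longrightarrow> has_P4 (insert {x, y} (reds (h @ [(e, c)])))"
    by (erule has_P4_mono) auto
  then show "virtual_edge h x y \<Longrightarrow> virtual_edge (h @ [(e, c)]) x y"
    unfolding virtual_edge_def by auto
qed

lemma successively_virtual_snoc:
  "successively (virtual_edge h) p \<Longrightarrow> successively (virtual_edge (h @ [(e, c)])) p"
  by (rule successively_mono[of "virtual_edge h"]) (auto intro: virtual_edge_snoc)

text \<open>Builder draws the missing edges one by one, in any order; a red answer completes a red
  \<open>P\<^sub>4\<close> within the same number of rounds.\<close>

lemma wins_if_virtual_path:
  assumes "distinct p" "length p = Suc l" "successively (virtual_edge h) p" "legal_history h"
    and "length h + card (path_edges p - blues h) \<le> N"
  shows "wins (path_graph 4) (path_graph (l + 1)) N h"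
  using assms(3-)
proof (induction "card (path_edges p - blues h)" arbitrary: h)
  case 0
  then have "path_edges p \<subseteq> blues h" by auto
  then have "contains_copy (blues h) (path_graph (l + 1))"
    unfolding contains_copy_path_iff using assms(1,2) path_edges_nth by (intro exI[of _ p]) fastforce
  then show ?case using 0 by (intro wins.won) (auto simp: builder_won_def)
next
  case (Suc n)
  then obtain e where e: "e \<in> path_edges p" "e \<notin> blues h"
    by (metis DiffE card.empty ex_in_conv nat.distinct(1))
  then obtain x y where xy: "e = {x, y}" "virtual_edge h x y"
    using successively_path_edges Suc.prems(1) by blast
  then have P4: "has_P4 (insert e (reds h))"
    using e by (auto simp: virtual_edge_def)
  show ?case
  \<comment> \<open>A virtual edge may already be red; then the red graph itself contains the
    \<open>P\<^sub>4\<close>.\<close>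
  proof (cases "e \<in> reds h")
    case True
    then show ?thesis
      using P4 Suc.prems by (intro wins.won) (auto simp: builder_won_def contains_copy_P4_iff insert_absorb)
  next
    case False
    have "card e = 2"
      using e(1) assms(1) by (induction p rule: path_edges.induct) auto
    then have legal: "legal_move h e"
      using False e(2) reds_Un_blues[of h] by (auto simp: legal_move_def)
    have "path_edges p - blues (h @ [(e, Blue)]) = path_edges p - blues h - {e}" by auto
    then have "card (path_edges p - blues (h @ [(e, Blue)])) = n"
      using Suc.hyps(2) e by simp
    then have "wins (path_graph 4) (path_graph (l + 1)) N (h @ [(e, Blue)])"
      using Suc legal by (intro Suc.hyps(1)) (auto intro: successively_virtual_snoc)
    moreover have "wins (path_graph 4) (path_graph (l + 1)) N (h @ [(e, Red)])"
      using P4 Suc.hyps(2) Suc.prems by (intro wins.won) (auto simp: builder_won_def contains_copy_P4_iff)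
    ultimately have "wins (path_graph 4) (path_graph (l + 1)) N (h @ [(e, c)])" for c
      by (cases c) auto
    then show ?thesis using legal by (rule wins.move[rotated])
  qed
qed

text \<open>
  What is known about an end of a path: it has no red edge (\<open>Free\<close>), it has one (\<open>Touched\<close>), it has one and
  every other \<open>Paired\<close> end with the same label is its red neighbour (\<open>Paired\<close>), or it is an end of a red
  \<open>P\<^sub>3\<close> (\<open>Leaf\<close>). Labels are constant on red components, so ends with different labels lie in different
  components. A \<open>Pnt\<close> is a single vertex. A \<open>Seg\<close> may be one, too, but only if no later red edge can
  invalidate what is known about its two coinciding ends.
\<close>

datatype kind = Free | Touched nat | Paired nat | Leaf nat

datatype seg = Pnt kind | Seg kind kind

fun left_kind :: "seg \<Rightarrow> kind" where
  "left_kind (Pnt k) = k" | "left_kind (Seg k k') = k"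

fun right_kind :: "seg \<Rightarrow> kind" where
  "right_kind (Pnt k) = k" | "right_kind (Seg k k') = k'"

fun flip :: "seg \<Rightarrow> seg" where
  "flip (Pnt k) = Pnt k" | "flip (Seg k k') = Seg k' k"

fun set_left :: "seg \<Rightarrow> kind \<Rightarrow> seg" where
  "set_left (Pnt _) k = Pnt k" | "set_left (Seg _ k') k = Seg k k'"

fun set_right :: "seg \<Rightarrow> kind \<Rightarrow> seg" where
  "set_right (Pnt _) k = Pnt k" | "set_right (Seg k' _) k = Seg k' k"

fun map_kinds :: "(kind \<Rightarrow> kind) \<Rightarrow> seg \<Rightarrow> seg" where
  "map_kinds f (Pnt k) = Pnt (f k)" | "map_kinds f (Seg k k') = Seg (f k) (f k')"

text \<open>If both ends are the same vertex, a red edge drawn at one of them would leave a false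
  \<open>Free\<close> at the other, or turn a \<open>Paired\<close> there into an unjustified
  \<open>Leaf\<close>. The kinds \<open>Touched\<close> and \<open>Leaf\<close> assert only that
  certain red edges exist.\<close>

fun persistent :: "kind \<Rightarrow> bool" where
  "persistent (Touched _) = True" | "persistent (Leaf _) = True" | "persistent _ = False"

fun kind_ok :: "history \<Rightarrow> (nat \<Rightarrow> nat) \<Rightarrow> kind \<Rightarrow> nat \<Rightarrow> bool" where
  "kind_ok h lab Free v \<longleftrightarrow> (\<forall>e\<in>reds h. v \<notin> e)"
| "kind_ok h lab (Touched i) v \<longleftrightarrow> lab v = i \<and> (\<exists>w. {v, w} \<in> reds h)"
| "kind_ok h lab (Paired i) v \<longleftrightarrow> lab v = i \<and> (\<exists>w. {v, w} \<in> reds h)"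
| "kind_ok h lab (Leaf i) v \<longleftrightarrow> lab v = i \<and> (\<exists>c w. {v, c} \<in> reds h \<and> {c, w} \<in> reds h \<and> w \<noteq> v)"

fun shape_ok :: "nat list \<Rightarrow> seg \<Rightarrow> bool" where
  "shape_ok p (Pnt k) \<longleftrightarrow> length p = 1"
| "shape_ok p (Seg k k') \<longleftrightarrow> p \<noteq> [] \<and> (length p = 1 \<longrightarrow> persistent k \<and> persistent k')"

definition ends_of :: "(nat list \<times> seg) list \<Rightarrow> (nat \<times> kind) set" where
  "ends_of ps = (\<Union>(p, s)\<in>set ps. {(hd p, left_kind s), (last p, right_kind s)})"

text \<open>\<open>same_label\<close> is one-sided: different red components may share a label,
  which only loses information. \<open>blues_covered\<close> says that no blue edge was wasted; it
  bounds the number of blue edges by \<open>edge_count\<close> and shows that an edge between two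
  paths of the family is not yet blue.\<close>

locale realizes =
  fixes h :: history and lab :: "nat \<Rightarrow> nat" and ps :: "(nat list \<times> seg) list"
  assumes legal: "legal_history h"
    and same_label: "{x, y} \<in> reds h \<Longrightarrow> lab x = lab y"
    and disjoint: "distinct (concat (map fst ps))"
    and segs_ok: "(p, s) \<in> set ps \<Longrightarrow> shape_ok p s \<and> successively (virtual_edge h) p"
    and blues_covered: "blues h \<subseteq> (\<Union>p\<in>fst ` set ps. path_edges p)"
    and ends_ok: "(v, k) \<in> ends_of ps \<Longrightarrow> kind_ok h lab k v"
    and paired: "(u, Paired i) \<in> ends_of ps \<Longrightarrow> (v, Paired i) \<in> ends_of ps \<Longrightarrow> u \<noteq> v \<Longrightarrow> {u, v} \<in> reds h"

definition edge_count :: "(nat list \<times> seg) list \<Rightarrow> nat" where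
  "edge_count ps = (\<Sum>(p, s)\<leftarrow>ps. length p - 1)"

lemma shape_ok_nonempty: "shape_ok p s \<Longrightarrow> p \<noteq> []"
  by (cases s) auto

lemma ends_of_Cons [simp]:
  "ends_of ((p, s) # ps) = {(hd p, left_kind s), (last p, right_kind s)} \<union> ends_of ps"
  by (simp add: ends_of_def)

lemma ends_of_Nil [simp]: "ends_of [] = {}"
  by (simp add: ends_of_def)

lemma edge_count_Cons [simp]: "edge_count ((p, s) # ps) = length p - 1 + edge_count ps"
  by (simp add: edge_count_def)

lemma ends_of_in_concat:
  assumes "(v, k) \<in> ends_of ps" "\<forall>(p, s)\<in>set ps. shape_ok p s"
  shows "v \<in> set (concat (map fst ps))"
  using assms unfolding ends_of_def by (force dest: shape_ok_nonempty)

lemmas realizesI = realizes.intro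
lemmas realizesD = realizes.legal realizes.same_label realizes.disjoint realizes.segs_ok
  realizes.blues_covered realizes.ends_ok realizes.paired

section \<open>Changes of the family that cost no round\<close>

lemma realizes_rearrange:
  assumes "realizes h lab ps" "distinct (concat (map fst ps'))"
    and "\<And>p s. (p, s) \<in> set ps' \<Longrightarrow> shape_ok p s \<and> successively (virtual_edge h) p"
    and "(\<Union>p\<in>fst ` set ps. path_edges p) \<subseteq> (\<Union>p\<in>fst ` set ps'. path_edges p)"
    and "ends_of ps' \<subseteq> ends_of ps"
  shows "realizes h lab ps'"
proof (rule realizesI)
  show "blues h \<subseteq> (\<Union>p\<in>fst ` set ps'. path_edges p)"
    using realizesD(5)[OF assms(1)] assms(4) by (rule subset_trans)
  show "kind_ok h lab k v" if "(v, k) \<in> ends_of ps'" for v k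
    using realizesD(6)[OF assms(1)] assms(5) that by blast
  show "{u, v} \<in> reds h" if "(u, Paired i) \<in> ends_of ps'" "(v, Paired i) \<in> ends_of ps'" "u \<noteq> v" for u v i
    using realizesD(7)[OF assms(1)] assms(5) that by blast
qed (fact realizesD(1,2)[OF assms(1)] assms(2,3))+

lemma realizes_pick:
  assumes "realizes h lab (xs @ a # ys)"
  shows "realizes h lab (a # xs @ ys)"
  using assms
proof (rule realizes_rearrange)
  show "distinct (concat (map fst (a # xs @ ys)))"
    using realizesD(3)[OF assms] by auto
qed (use realizesD(4)[OF assms] in \<open>auto simp: ends_of_def\<close>)

lemma realizes_flip:
  assumes "realizes h lab ((p, s) # ps)"
  shows "realizes h lab ((rev p, flip s) # ps)"
  using assms
proof (rule realizes_rearrange)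
  have p: "shape_ok p s" "successively (virtual_edge h) p" "p \<noteq> []"
    using realizesD(4)[OF assms] shape_ok_nonempty by auto
  show "ends_of ((rev p, flip s) # ps) \<subseteq> ends_of ((p, s) # ps)"
    using p(3) by (cases s) (auto simp: hd_rev last_rev)
  have "shape_ok (rev p) (flip s)"
    using p(1) by (cases s) auto
  moreover have "successively (virtual_edge h) (rev p)"
    unfolding successively_rev using p(2) virtual_edge_commute by (auto elim: successively_mono)
  ultimately show "shape_ok q t \<and> successively (virtual_edge h) q" if "(q, t) \<in> set ((rev p, flip s) # ps)" for q t
    using that realizesD(4)[OF assms] by auto
qed (use realizesD(3)[OF assms] in auto)

lemma realizes_new:
  assumes "realizes h lab ps"
  shows "\<exists>v. realizes h lab (([v], Pnt Free) # ps)"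
proof -
  obtain v where v: "v \<notin> set (concat (map fst ps))" "\<And>e. e \<in> fst ` set h \<Longrightarrow> v \<notin> e"
    using exists_fresh_vertex[OF realizesD(1)[OF assms], of "set (concat (map fst ps))"] by blast
  have "kind_ok h lab Free v" using reds_Un_blues[of h] v(2) by auto
  then have "realizes h lab (([v], Pnt Free) # ps)"
    using realizesD[OF assms] v(1) by (intro realizesI) auto
  then show ?thesis by blast
qed

text \<open>A point is declared to be a segment without edges, so that it can share a table entry
  with genuine segments that have such ends.\<close>

lemma realizes_widen:
  assumes "realizes h lab ((p, Pnt k) # ps)" "persistent k"
  shows "realizes h lab ((p, Seg k k) # ps)"
  using assms(1)
proof (rule realizes_rearrange)
  have "shape_ok p (Pnt k) \<and> successively (virtual_edge h) p"
    using realizesD(4)[OF assms(1), of p "Pnt k"] by simp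
  then show "shape_ok q t \<and> successively (virtual_edge h) q" if "(q, t) \<in> set ((p, Seg k k) # ps)" for q t
    using that realizesD(4)[OF assms(1), of q t] assms(2) by auto
qed (use realizesD(3)[OF assms(1)] in auto)

lemma realizes_join:
  assumes "realizes h lab ((p, s) # (q, t) # ps)" "virtual_edge h (last p) (hd q)"
  shows "realizes h lab ((p @ q, Seg (left_kind s) (right_kind t)) # ps)"
  using assms(1)
proof (rule realizes_rearrange)
  have pq: "p \<noteq> []" "q \<noteq> []" "successively (virtual_edge h) p" "successively (virtual_edge h) q"
    using realizesD(4)[OF assms(1)] shape_ok_nonempty by auto
  have "length (p @ q) \<noteq> 1"
    using pq by (cases p; cases q) auto
  then show "shape_ok p' s' \<and> successively (virtual_edge h) p'"
    if "(p', s') \<in> set ((p @ q, Seg (left_kind s) (right_kind t)) # ps)" for p' s'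
    using that realizesD(4)[OF assms(1)] pq assms(2) by (auto simp: successively_append_iff)
  show "ends_of ((p @ q, Seg (left_kind s) (right_kind t)) # ps) \<subseteq> ends_of ((p, s) # (q, t) # ps)"
    using pq by auto
qed (use realizesD(3)[OF assms(1)] in \<open>auto simp: path_edges_append\<close>)

lemma ends_of_map: "ends_of (map (\<lambda>(p, s). (p, map_kinds f s)) ps) = (\<lambda>(v, k). (v, f k)) ` ends_of ps"
proof -
  have "left_kind (map_kinds f s) = f (left_kind s)" "right_kind (map_kinds f s) = f (right_kind s)" for s
    by (cases s; simp)+
  then show ?thesis by (induction ps) auto
qed

lemma realizes_map_kinds:
  assumes "realizes h lab ps"
    and "\<And>x y. lab x = lab y \<Longrightarrow> lab' x = lab' y"
    and "\<And>k. persistent k \<Longrightarrow> persistent (f k)"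
    and "\<And>v k. kind_ok h lab k v \<Longrightarrow> kind_ok h lab' (f k) v"
    and "\<And>u v k k' i. (u, k) \<in> ends_of ps \<Longrightarrow> (v, k') \<in> ends_of ps \<Longrightarrow> f k = Paired i \<Longrightarrow> f k' = Paired i \<Longrightarrow>
           u \<noteq> v \<Longrightarrow> {u, v} \<in> reds h"
  shows "realizes h lab' (map (\<lambda>(p, s). (p, map_kinds f s)) ps)"
proof (rule realizesI)
  have shape: "shape_ok p s \<Longrightarrow> shape_ok p (map_kinds f s)" for p s
    using assms(3) by (cases s) auto
  show "shape_ok p s \<and> successively (virtual_edge h) p"
    if "(p, s) \<in> set (map (\<lambda>(p, s). (p, map_kinds f s)) ps)" for p s
    using that realizesD(4)[OF assms(1)] shape by auto
  have fst_map: "map fst (map (\<lambda>(p, s). (p, map_kinds f s)) ps) = map fst ps"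
    by (simp add: comp_def split_beta)
  show "distinct (concat (map fst (map (\<lambda>(p, s). (p, map_kinds f s)) ps)))"
    unfolding fst_map by (rule realizesD(3)[OF assms(1)])
  have "fst ` set (map (\<lambda>(p, s). (p, map_kinds f s)) ps) = fst ` set ps"
    by (metis fst_map set_map)
  then show "blues h \<subseteq> (\<Union>p\<in>fst ` set (map (\<lambda>(p, s). (p, map_kinds f s)) ps). path_edges p)"
    using realizesD(5)[OF assms(1)] by simp
  show "kind_ok h lab' k v" if "(v, k) \<in> ends_of (map (\<lambda>(p, s). (p, map_kinds f s)) ps)" for v k
    using that realizesD(6)[OF assms(1)] assms(4) unfolding ends_of_map by auto
  show "{u, v} \<in> reds h"
    if "(u, Paired i) \<in> ends_of (map (\<lambda>(p, s). (p, map_kinds f s)) ps)"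
      "(v, Paired i) \<in> ends_of (map (\<lambda>(p, s). (p, map_kinds f s)) ps)" "u \<noteq> v" for u v i
    using that assms(5) unfolding ends_of_map by (auto simp: image_iff) metis
  show "lab' x = lab' y" if "{x, y} \<in> reds h" for x y
    using realizesD(2)[OF assms(1) that] by (rule assms(2))
qed (fact realizesD(1)[OF assms(1)])

fun unpair :: "nat \<Rightarrow> kind \<Rightarrow> kind" where
  "unpair i (Paired j) = (if i = j then Touched j else Paired j)"
| "unpair i k = k"

text \<open>\<open>Touched\<close> asserts less than \<open>Paired\<close>; forgetting partners lets
  more positions share a table entry.\<close>

lemma realizes_unpair:
  assumes "realizes h lab ps"
  shows "realizes h lab (map (\<lambda>(p, s). (p, map_kinds (unpair i) s)) ps)"
  using assms
proof (rule realizes_map_kinds)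
  show "persistent k \<Longrightarrow> persistent (unpair i k)" for k by (cases k) auto
  show "kind_ok h lab k v \<Longrightarrow> kind_ok h lab (unpair i k) v" for k v by (cases k) auto
  have "unpair i k = Paired j \<Longrightarrow> k = Paired j" for k j by (cases k) (auto split: if_splits)
  then show "{u, v} \<in> reds h"
    if "(u, k) \<in> ends_of ps" "(v, k') \<in> ends_of ps" "unpair i k = Paired j" "unpair i k' = Paired j" "u \<noteq> v"
    for u v k k' j
    using that realizesD(7)[OF assms] by blast
qed

fun relabel :: "nat list \<Rightarrow> kind \<Rightarrow> kind" where
  "relabel ls Free = Free"
| "relabel ls (Touched i) = Touched (ls ! i)"
| "relabel ls (Paired i) = Paired (ls ! i)"
| "relabel ls (Leaf i) = Leaf (ls ! i)"

fun paired_label :: "kind \<Rightarrow> nat list" where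
  "paired_label (Paired i) = [i]"
| "paired_label _ = []"

fun paired_labels :: "seg list \<Rightarrow> nat list" where
  "paired_labels [] = []"
| "paired_labels (s # S) = paired_label (left_kind s) @ paired_label (right_kind s) @ paired_labels S"

lemma Paired_ends_of: "(v, Paired i) \<in> ends_of ps \<Longrightarrow> i \<in> set (paired_labels (map snd ps))"
proof (induction ps)
  case (Cons a ps)
  then show ?case by (cases a) (auto, (metis paired_label.simps(1) list.set_intros(1))+)
qed simp

text \<open>Merging labels only gives up the knowledge that two components differ, except for
  \<open>Paired\<close> labels, whose equality asserts a red edge. Beyond the end of
  \<open>ls\<close> the value \<open>ls ! i\<close> is unspecified but fixed; it matters only that
  the new label is a function of the old one.\<close>

lemma realizes_relabel:
  assumes "realizes h lab ps"
    and "\<forall>i\<in>set (paired_labels (map snd ps)). \<forall>j\<in>set (paired_labels (map snd ps)). ls ! i = ls ! j \<longrightarrow> i = j"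
  shows "realizes h (\<lambda>v. ls ! lab v) (map (\<lambda>(p, s). (p, map_kinds (relabel ls) s)) ps)"
  using assms(1)
proof (rule realizes_map_kinds)
  show "persistent k \<Longrightarrow> persistent (relabel ls k)" for k by (cases k) auto
  show "kind_ok h lab k v \<Longrightarrow> kind_ok h (\<lambda>v. ls ! lab v) (relabel ls k) v" for k v by (cases k) auto
  show "{u, v} \<in> reds h"
    if uv: "(u, k) \<in> ends_of ps" "(v, k') \<in> ends_of ps" "relabel ls k = Paired i" "relabel ls k' = Paired i" "u \<noteq> v"
    for u v k k' i
  proof -
    obtain a b where k: "k = Paired a" "k' = Paired b" "ls ! a = ls ! b"
      using uv(3,4) by (cases k; cases k') auto
    then have "a = b" using Paired_ends_of uv(1,2) assms(2) by blast
    then show ?thesis using uv k realizesD(7)[OF assms(1)] by blast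
  qed
qed simp

section \<open>Forced edges between path ends\<close>

fun label_of :: "kind \<Rightarrow> nat option" where
  "label_of Free = None"
| "label_of (Touched i) = Some i"
| "label_of (Paired i) = Some i"
| "label_of (Leaf i) = Some i"

fun is_leaf :: "kind \<Rightarrow> bool" where
  "is_leaf (Leaf _) = True" | "is_leaf _ = False"

text \<open>Different labels mean different red components. An edge between red edges of two
  components is the middle of a red \<open>P\<^sub>4\<close>; an edge from a free vertex to a
  \<open>Leaf\<close> is its first edge. Two free ends are ruled out because both have the label
  \<open>None\<close>.\<close>

definition joinable :: "kind \<Rightarrow> kind \<Rightarrow> bool" where
  "joinable k k' \<longleftrightarrow> label_of k \<noteq> label_of k' \<and>
     (k = Free \<longrightarrow> is_leaf k') \<and> (k' = Free \<longrightarrow> is_leaf k)"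

lemma kind_ok_labelled:
  assumes "kind_ok h lab k v" "k \<noteq> Free"
  obtains w where "label_of k = Some (lab v)" "{v, w} \<in> reds h"
  using assms by (cases k) auto

lemma virtual_edge_touched:
  assumes "\<And>x y. {x, y} \<in> reds h \<Longrightarrow> lab x = lab y" "legal_history h"
    and "{u, u'} \<in> reds h" "{v, v'} \<in> reds h" "lab u \<noteq> lab v"
  shows "virtual_edge h u v"
proof -
  have "u' \<noteq> u" "v \<noteq> v'"
    using assms(3,4) legal_history_no_loop[OF assms(2)] by blast+
  moreover have "lab u' = lab u" "lab v' = lab v"
    using assms(1)[OF assms(3)] assms(1)[OF assms(4)] by simp_all
  \<comment> \<open>The labels separate the two red edges, so their four ends are distinct.\<close>
  ultimately have "distinct [u', u, v, v']"
    using assms(5) by auto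
  then have "has_P4 (insert {u, v} (reds h))"
    using assms(3,4) by (intro has_P4I[of u' u v v']) (auto simp: insert_commute)
  then show ?thesis by (simp add: virtual_edge_def)
qed

lemma virtual_edge_leaf_free:
  assumes "legal_history h" "kind_ok h lab k u" "is_leaf k" "kind_ok h lab Free v"
  shows "virtual_edge h v u"
proof -
  obtain c w where cw: "{u, c} \<in> reds h" "{c, w} \<in> reds h" "w \<noteq> u"
    using assms(2,3) by (cases k) auto
  have free: "v \<notin> e" if "e \<in> reds h" for e
    using assms(4) that by simp
  have "u \<noteq> c" "c \<noteq> w"
    using cw legal_history_no_loop[OF assms(1)] by blast+
  then have "distinct [v, u, c, w]"
    using cw(3) free[OF cw(1)] free[OF cw(2)] by auto
  then have "has_P4 (insert {v, u} (reds h))"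
    using cw by (intro has_P4I[of v u c w]) auto
  then show ?thesis by (simp add: virtual_edge_def)
qed

lemma virtual_edge_joinable:
  assumes "realizes h lab ps" "kind_ok h lab k u" "kind_ok h lab k' v" "joinable k k'"
  shows "virtual_edge h u v"
proof -
  note legal = realizesD(1)[OF assms(1)]
  consider "k = Free" "is_leaf k'" | "k' = Free" "is_leaf k" | "k \<noteq> Free" "k' \<noteq> Free"
    using assms(4) by (auto simp: joinable_def)
  then show ?thesis
  proof cases
    case 1
    then show ?thesis using virtual_edge_leaf_free[OF legal assms(3)] assms(2) by simp
  next
    case 2
    then show ?thesis
      unfolding virtual_edge_commute[of h u] using virtual_edge_leaf_free[OF legal assms(2)] assms(3) by simp
  next
    case 3
    obtain u' where u': "label_of k = Some (lab u)" "{u, u'} \<in> reds h"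
      using kind_ok_labelled[OF assms(2) 3(1)] .
    obtain v' where v': "label_of k' = Some (lab v)" "{v, v'} \<in> reds h"
      using kind_ok_labelled[OF assms(3) 3(2)] .
    have "lab u \<noteq> lab v" using u' v' assms(4) by (simp add: joinable_def)
    then show ?thesis
      using virtual_edge_touched[OF realizesD(2)[OF assms(1)] legal u'(2) v'(2)] by simp
  qed
qed

section \<open>The effect of one round on the family\<close>

lemma ends_of_pair_Un: "ends_of (a # b # ps) = ends_of [a] \<union> ends_of [b] \<union> ends_of ps"
  by (auto simp: ends_of_def)

lemma kind_ok_cong: "reds h = reds h' \<Longrightarrow> kind_ok h lab k v \<longleftrightarrow> kind_ok h' lab k v"
  by (cases k) auto

lemma kind_ok_red:
  assumes "kind_ok h lab k v" "lab' v = lab v" "k = Free \<Longrightarrow> v \<notin> e"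
  shows "kind_ok (h @ [(e, Red)]) lab' k v"
  using assms by (cases k) auto

lemma realizes_disjoint:
  assumes "realizes h lab ((p, s) # (q, t) # ps)"
  shows "p \<noteq> []" "q \<noteq> []" "distinct p" "distinct q" "set p \<inter> set q = {}"
    and "\<And>v k. (v, k) \<in> ends_of ps \<Longrightarrow> v \<notin> set p \<union> set q"
    and "\<And>r. r \<in> fst ` set ps \<Longrightarrow> set r \<inter> (set p \<union> set q) = {}"
proof -
  note D = realizesD(3)[OF assms]
  show "p \<noteq> []" "q \<noteq> []"
    using realizesD(4)[OF assms, of p s] realizesD(4)[OF assms, of q t] shape_ok_nonempty by auto
  show "distinct p" "distinct q" "set p \<inter> set q = {}"
    using D by auto
  have "\<forall>(p, s)\<in>set ps. shape_ok p s"
    using realizesD(4)[OF assms] by auto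
  then show "v \<notin> set p \<union> set q" if "(v, k) \<in> ends_of ps" for v k
    using ends_of_in_concat[OF that] D by auto
  show "set r \<inter> (set p \<union> set q) = {}" if "r \<in> fst ` set ps" for r
    using D that by auto
qed

text \<open>A free end excludes a red edge. A blue one would lie on one path of the family, but its
  two vertices are on different paths.\<close>

lemma realizes_legal_move:
  assumes "realizes h lab ((p, s) # (q, t) # ps)" "right_kind s = Free"
  shows "legal_move h {last p, hd q}"
proof -
  note D = realizes_disjoint[OF assms(1)]
  have mem: "last p \<in> set p" "hd q \<in> set q" using D(1,2) by auto
  have "kind_ok h lab Free (last p)"
    using realizesD(6)[OF assms(1), of "last p" Free] assms(2) by simp
  then have "{last p, hd q} \<notin> reds h" by auto
  moreover have "{last p, hd q} \<notin> blues h"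
  proof
    assume "{last p, hd q} \<in> blues h"
    then obtain r where r: "r \<in> fst ` set ((p, s) # (q, t) # ps)" "{last p, hd q} \<in> path_edges r"
      using realizesD(5)[OF assms(1)] by blast
    then have "last p \<in> set r" "hd q \<in> set r" using path_edges_subset by blast+
    then show False using r(1) D(5) D(7)[of r] mem by auto
  qed
  ultimately have "{last p, hd q} \<notin> fst ` set h" using reds_Un_blues[of h] by blast
  moreover have "last p \<noteq> hd q" using mem D(5) by auto
  ultimately show ?thesis by (simp add: legal_move_def)
qed

lemma realizes_draw_blue:
  assumes "realizes h lab ((p, s) # (q, t) # ps)" "legal_move h {last p, hd q}"
  shows "realizes (h @ [({last p, hd q}, Blue)]) lab ((p @ q, Seg (left_kind s) (right_kind t)) # ps)"
proof (rule realizesI)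
  let ?h = "h @ [({last p, hd q}, Blue)]"
  let ?ps = "(p @ q, Seg (left_kind s) (right_kind t)) # ps"
  note D = realizes_disjoint[OF assms(1)]
  have reds: "reds ?h = reds h" by simp
  have ends: "ends_of ?ps \<subseteq> ends_of ((p, s) # (q, t) # ps)"
    using D(1,2) by auto
  show "legal_history ?h" using assms(2) realizesD(1)[OF assms(1)] by simp
  show "lab x = lab y" if "{x, y} \<in> reds ?h" for x y
    using realizesD(2)[OF assms(1)] that reds by simp
  show "distinct (concat (map fst ?ps))" using realizesD(3)[OF assms(1)] by simp
  have "virtual_edge ?h (last p) (hd q)" by (simp add: virtual_edge_def)
  moreover have "length (p @ q) \<noteq> 1" using D(1,2) by (cases p; cases q) auto
  ultimately show "shape_ok p' s' \<and> successively (virtual_edge ?h) p'" if "(p', s') \<in> set ?ps" for p' s'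
    using that realizesD(4)[OF assms(1), of p' s'] realizesD(4)[OF assms(1), of p s]
      realizesD(4)[OF assms(1), of q t] D(1)
    by (auto simp: successively_append_iff intro: successively_virtual_snoc)
  show "blues ?h \<subseteq> (\<Union>p\<in>fst ` set ?ps. path_edges p)"
    using realizesD(5)[OF assms(1)] D(1,2) by (auto simp: path_edges_append)
  show "kind_ok ?h lab k v" if "(v, k) \<in> ends_of ?ps" for v k
    using realizesD(6)[OF assms(1), of v k] that ends kind_ok_cong[OF reds] by blast
  show "{u, v} \<in> reds ?h" if "(u, Paired i) \<in> ends_of ?ps" "(v, Paired i) \<in> ends_of ?ps" "u \<noteq> v" for u v i
    unfolding reds using realizesD(7)[OF assms(1), of u i v] that ends by blast
qed

lemma realizes_draw_red:
  assumes R: "realizes h lab ps" and "legal_move h e" "map fst ps' = map fst ps"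
    and "\<And>x y. {x, y} \<in> insert e (reds h) \<Longrightarrow> lab' x = lab' y"
    and shape: "\<And>p s. (p, s) \<in> set ps' \<Longrightarrow> shape_ok p s"
    and "\<And>v k. (v, k) \<in> ends_of ps' \<Longrightarrow> kind_ok (h @ [(e, Red)]) lab' k v"
    and "\<And>u v i. (u, Paired i) \<in> ends_of ps' \<Longrightarrow> (v, Paired i) \<in> ends_of ps' \<Longrightarrow> u \<noteq> v \<Longrightarrow>
           {u, v} \<in> insert e (reds h)"
  shows "realizes (h @ [(e, Red)]) lab' ps'"
proof (rule realizesI)
  have fst: "fst ` set ps' = fst ` set ps" using assms(3) by (metis set_map)
  show "shape_ok p s \<and> successively (virtual_edge (h @ [(e, Red)])) p" if "(p, s) \<in> set ps'" for p s
  proof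
    have "p \<in> fst ` set ps" using that fst by force
    then obtain s' where "(p, s') \<in> set ps" by force
    then show "successively (virtual_edge (h @ [(e, Red)])) p"
      using realizesD(4)[OF R] successively_virtual_snoc by blast
  qed (rule shape[OF that])
  show "legal_history (h @ [(e, Red)])" using realizesD(1)[OF R] assms(2) by simp
  show "blues (h @ [(e, Red)]) \<subseteq> (\<Union>p\<in>fst ` set ps'. path_edges p)"
    using realizesD(5)[OF R] fst by simp
  show "distinct (concat (map fst ps'))" using realizesD(3)[OF R] assms(3) by simp
qed (use assms(4,6,7) in simp_all)

text \<open>As the replaced kind is not persistent, a \<open>Seg\<close> has two different ends
  here. So the old kind of \<open>last p\<close> disappears and cannot survive at the opposite
  end.\<close>

lemma ends_of_set_right:
  assumes "shape_ok p s" "distinct p" "\<not> persistent (right_kind s)"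
  shows "ends_of [(p, set_right (map_kinds f s) k)] \<subseteq>
    insert (last p, k) ((\<lambda>(v, k). (v, f k)) ` {(v, k) \<in> ends_of [(p, s)]. v \<noteq> last p})"
proof (cases s)
  case (Pnt k')
  then show ?thesis using assms(1) by (auto simp: length_Suc_conv)
next
  case (Seg a b)
  then have "p \<noteq> []" "length p \<noteq> 1" using assms by auto
  then have "hd p \<noteq> last p" using assms(2) by (cases p) (auto split: if_splits)
  then show ?thesis using Seg by auto
qed

lemma ends_of_set_left:
  assumes "shape_ok p s" "distinct p" "\<not> persistent (left_kind s)"
  shows "ends_of [(p, set_left (map_kinds f s) k)] \<subseteq>
    insert (hd p, k) ((\<lambda>(v, k). (v, f k)) ` {(v, k) \<in> ends_of [(p, s)]. v \<noteq> hd p})"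
proof (cases s)
  case (Pnt k')
  then show ?thesis using assms(1) by (auto simp: length_Suc_conv)
next
  case (Seg a b)
  then have "p \<noteq> []" "length p \<noteq> 1" using assms by auto
  then have "hd p \<noteq> last p" using assms(2) by (cases p) (auto split: if_splits)
  then show ?thesis using Seg by auto
qed

lemma shape_ok_set_right: "shape_ok p s \<Longrightarrow> \<not> persistent (right_kind s) \<Longrightarrow> shape_ok p (set_right (map_kinds f s) k)"
  by (cases s) auto

lemma shape_ok_set_left: "shape_ok p s \<Longrightarrow> \<not> persistent (left_kind s) \<Longrightarrow> shape_ok p (set_left (map_kinds f s) k)"
  by (cases s) auto

lemma map_kinds_id [simp]: "map_kinds (\<lambda>k. k) s = s"
  by (cases s) auto

text \<open>The label \<open>i\<close> must be new among \<open>Paired\<close> labels only, since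
  these assert red edges. Sharing it with a \<open>Touched\<close> or \<open>Leaf\<close> end merely
  makes two components look like one.\<close>

lemma realizes_draw_free_free:
  assumes R: "realizes h lab ((p, s) # (q, t) # ps)" and kinds: "right_kind s = Free" "left_kind t = Free"
    and new: "i \<notin> set (paired_labels (s # t # map snd ps))"
  shows "realizes (h @ [({last p, hd q}, Red)]) (lab(last p := i, hd q := i))
    ((p, set_right s (Paired i)) # (q, set_left t (Paired i)) # ps)" (is "realizes ?h ?lab ?ps")
proof (rule realizes_draw_red[OF R realizes_legal_move[OF R kinds(1)]])
  let ?old = "(p, s) # (q, t) # ps"
  note D = realizes_disjoint[OF R]
  have mem: "last p \<in> set p" "hd q \<in> set q" using D(1,2) by auto
  have sh: "shape_ok p s" "shape_ok q t" using realizesD(4)[OF R] by auto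
  have free: "last p \<notin> e" "hd q \<notin> e" if "e \<in> reds h" for e
    using realizesD(6)[OF R, of "last p" Free] realizesD(6)[OF R, of "hd q" Free] kinds that by auto
  \<comment> \<open>All other ends sit at other vertices, because the paths are disjoint; this is
    why their kinds survive the new red edge.\<close>
  have ends: "ends_of ?ps \<subseteq> {(last p, Paired i), (hd q, Paired i)} \<union>
      {(v, k) \<in> ends_of ?old. v \<noteq> last p \<and> v \<noteq> hd q}"
  proof -
    have "ends_of [(p, set_right s (Paired i))] \<subseteq>
        insert (last p, Paired i) {(v, k) \<in> ends_of [(p, s)]. v \<noteq> last p}"
      using ends_of_set_right[OF sh(1) D(3), of "\<lambda>k. k"] kinds(1) by auto
    moreover have "ends_of [(q, set_left t (Paired i))] \<subseteq>
        insert (hd q, Paired i) {(v, k) \<in> ends_of [(q, t)]. v \<noteq> hd q}"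
      using ends_of_set_left[OF sh(2) D(4), of "\<lambda>k. k"] kinds(2) by auto
    moreover have "v \<in> set p" if "(v, k) \<in> ends_of [(p, s)]" for v k
      using that D(1) by auto
    moreover have "v \<in> set q" if "(v, k) \<in> ends_of [(q, t)]" for v k
      using that D(2) by auto
    ultimately show ?thesis
      unfolding ends_of_pair_Un[of _ _ ps] using D(5,6) mem by blast
  qed
  show "?lab x = ?lab y" if "{x, y} \<in> insert {last p, hd q} (reds h)" for x y
  proof (cases "{x, y} = {last p, hd q}")
    case False
    then have "{x, y} \<in> reds h" using that by simp
    then show ?thesis using free[of "{x, y}"] realizesD(2)[OF R] by auto
  qed (auto simp: doubleton_eq_iff)
  show "shape_ok p' s'" if "(p', s') \<in> set ?ps" for p' s'
    using that realizesD(4)[OF R, of p' s'] shape_ok_set_right[OF sh(1), of "\<lambda>k. k"]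
      shape_ok_set_left[OF sh(2), of "\<lambda>k. k"] kinds by auto
  show "kind_ok ?h ?lab k v" if vk: "(v, k) \<in> ends_of ?ps" for v k
  proof -
    consider "v \<in> {last p, hd q}" "k = Paired i" | "(v, k) \<in> ends_of ?old" "v \<noteq> last p" "v \<noteq> hd q"
      using ends vk by blast
    then show ?thesis
    proof cases
      case 1
      then show ?thesis by (auto simp: insert_commute)
    next
      case 2
      then show ?thesis using realizesD(6)[OF R 2(1)] by (intro kind_ok_red) auto
    qed
  qed
  show "{u, v} \<in> insert {last p, hd q} (reds h)"
    if "(u, Paired j) \<in> ends_of ?ps" "(v, Paired j) \<in> ends_of ?ps" "u \<noteq> v" for u v j
  proof (cases "j = i")
    case True
    have "(w, Paired i) \<notin> ends_of ?old" for w
      using Paired_ends_of[of w i ?old] new by auto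
    then have "u \<in> {last p, hd q}" "v \<in> {last p, hd q}"
      using ends that True by blast+
    then show ?thesis using that(3) by (auto simp: insert_commute)
  next
    case False
    then have "(u, Paired j) \<in> ends_of ?old" "(v, Paired j) \<in> ends_of ?old"
      using ends that by blast+
    then show ?thesis using realizesD(7)[OF R _ _ that(3)] by blast
  qed
qed simp

text \<open>Together with a red neighbour \<open>w\<close> of \<open>hd q\<close>, the new edge
  forms a red \<open>P\<^sub>3\<close> with ends \<open>last p\<close> and \<open>w\<close>; here
  \<open>w\<close> differs from \<open>last p\<close>, which had no red edge.\<close>

lemma realizes_draw_free_touched:
  assumes R: "realizes h lab ((p, s) # (q, t) # ps)" and kinds: "right_kind s = Free" "left_kind t = Touched j"
  shows "realizes (h @ [({last p, hd q}, Red)]) (lab(last p := j))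
    ((p, set_right s (Leaf j)) # (q, t) # ps)" (is "realizes ?h ?lab ?ps")
proof (rule realizes_draw_red[OF R realizes_legal_move[OF R kinds(1)]])
  let ?old = "(p, s) # (q, t) # ps"
  note D = realizes_disjoint[OF R]
  have mem: "last p \<in> set p" "hd q \<in> set q" using D(1,2) by auto
  have sh: "shape_ok p s" "shape_ok q t" using realizesD(4)[OF R] by auto
  have free: "last p \<notin> e" if "e \<in> reds h" for e
    using realizesD(6)[OF R, of "last p" Free] kinds that by auto
  obtain w where w: "lab (hd q) = j" "{hd q, w} \<in> reds h"
    using realizesD(6)[OF R, of "hd q" "Touched j"] kinds(2) by auto
  have ends: "ends_of ?ps \<subseteq> insert (last p, Leaf j) {(v, k) \<in> ends_of ?old. v \<noteq> last p}"
  proof -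
    have "ends_of [(p, set_right s (Leaf j))] \<subseteq>
        insert (last p, Leaf j) {(v, k) \<in> ends_of [(p, s)]. v \<noteq> last p}"
      using ends_of_set_right[OF sh(1) D(3), of "\<lambda>k. k"] kinds(1) by auto
    moreover have "v \<in> set q" if "(v, k) \<in> ends_of [(q, t)]" for v k
      using that D(2) by auto
    ultimately show ?thesis
      unfolding ends_of_pair_Un[of _ _ ps] using D(5,6) mem by blast
  qed
  show "?lab x = ?lab y" if "{x, y} \<in> insert {last p, hd q} (reds h)" for x y
  proof (cases "{x, y} = {last p, hd q}")
    case True
    then show ?thesis using w(1) by (auto simp: doubleton_eq_iff)
  next
    case False
    then have "{x, y} \<in> reds h" using that by simp
    then show ?thesis using free[of "{x, y}"] realizesD(2)[OF R] by auto
  qed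
  show "shape_ok p' s'" if "(p', s') \<in> set ?ps" for p' s'
    using that realizesD(4)[OF R, of p' s'] shape_ok_set_right[OF sh(1), of "\<lambda>k. k"] kinds by auto
  show "kind_ok ?h ?lab k v" if vk: "(v, k) \<in> ends_of ?ps" for v k
  proof -
    consider "v = last p" "k = Leaf j" | "(v, k) \<in> ends_of ?old" "v \<noteq> last p"
      using ends vk by blast
    then show ?thesis
    proof cases
      case 1
      have "w \<noteq> last p" using free[OF w(2)] by auto
      then show ?thesis using 1 w(2) by auto
    next
      case 2
      have "v \<noteq> hd q" if "k = Free"
        using realizesD(6)[OF R 2(1)] that w(2) by auto
      then show ?thesis using 2 realizesD(6)[OF R 2(1)] by (intro kind_ok_red) auto
    qed
  qed
  show "{u, v} \<in> insert {last p, hd q} (reds h)"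
    if "(u, Paired i) \<in> ends_of ?ps" "(v, Paired i) \<in> ends_of ?ps" "u \<noteq> v" for u v i
  proof -
    have "(u, Paired i) \<in> ends_of ?old" "(v, Paired i) \<in> ends_of ?old"
      using ends that by blast+
    then show ?thesis using realizesD(7)[OF R _ _ that(3)] by blast
  qed
qed simp

fun pair_to_leaf :: "nat \<Rightarrow> kind \<Rightarrow> kind" where
  "pair_to_leaf j (Paired i) = (if i = j then Leaf i else Paired i)"
| "pair_to_leaf j k = k"

text \<open>Now \<open>hd q\<close> is the centre of a red \<open>P\<^sub>3\<close>: every other end
  with the kind \<open>Paired j\<close> is its neighbour and thus becomes a leaf opposite to
  \<open>last p\<close>. So kinds change also at ends that the edge does not meet, anywhere in the
  family, while the centre itself is only \<open>Touched\<close>.\<close>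

lemma realizes_draw_free_paired:
  assumes R: "realizes h lab ((p, s) # (q, t) # ps)" and kinds: "right_kind s = Free" "left_kind t = Paired j"
  defines "f \<equiv> map_kinds (pair_to_leaf j)"
  shows "realizes (h @ [({last p, hd q}, Red)]) (lab(last p := j))
    ((p, set_right (f s) (Leaf j)) # (q, set_left (f t) (Touched j)) # map (\<lambda>(p, s). (p, f s)) ps)"
    (is "realizes ?h ?lab ?ps")
proof (rule realizes_draw_red[OF R realizes_legal_move[OF R kinds(1)]])
  let ?old = "(p, s) # (q, t) # ps"
  note D = realizes_disjoint[OF R]
  have mem: "last p \<in> set p" "hd q \<in> set q" using D(1,2) by auto
  then have ne: "last p \<noteq> hd q" using D(5) by auto
  have sh: "shape_ok p s" "shape_ok q t" using realizesD(4)[OF R] by auto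
  have free: "last p \<notin> e" if "e \<in> reds h" for e
    using realizesD(6)[OF R, of "last p" Free] kinds that by auto
  obtain w where w: "lab (hd q) = j" "{hd q, w} \<in> reds h"
    using realizesD(6)[OF R, of "hd q" "Paired j"] kinds(2) by auto
  have ends: "ends_of ?ps \<subseteq> {(last p, Leaf j), (hd q, Touched j)} \<union>
      (\<lambda>(v, k). (v, pair_to_leaf j k)) ` {(v, k) \<in> ends_of ?old. v \<noteq> last p \<and> v \<noteq> hd q}"
  proof -
    have 1: "ends_of [(p, set_right (f s) (Leaf j))] \<subseteq>
        insert (last p, Leaf j) ((\<lambda>(v, k). (v, pair_to_leaf j k)) ` {(v, k) \<in> ends_of [(p, s)]. v \<noteq> last p})"
      unfolding f_def using ends_of_set_right[OF sh(1) D(3)] kinds(1) by simp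
    have 2: "ends_of [(q, set_left (f t) (Touched j))] \<subseteq>
        insert (hd q, Touched j) ((\<lambda>(v, k). (v, pair_to_leaf j k)) ` {(v, k) \<in> ends_of [(q, t)]. v \<noteq> hd q})"
      unfolding f_def using ends_of_set_left[OF sh(2) D(4)] kinds(2) by simp
    have 3: "ends_of (map (\<lambda>(p, s). (p, f s)) ps) = (\<lambda>(v, k). (v, pair_to_leaf j k)) ` ends_of ps"
      unfolding f_def by (rule ends_of_map)
    have 4: "{(v, k) \<in> ends_of [(p, s)]. v \<noteq> last p} \<subseteq> {(v, k) \<in> ends_of ?old. v \<noteq> last p \<and> v \<noteq> hd q}"
      using hd_in_set[OF D(1)] D(5) mem by auto
    have 5: "{(v, k) \<in> ends_of [(q, t)]. v \<noteq> hd q} \<subseteq> {(v, k) \<in> ends_of ?old. v \<noteq> last p \<and> v \<noteq> hd q}"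
      using last_in_set[OF D(2)] D(5) mem by auto
    have 6: "ends_of ps \<subseteq> {(v, k) \<in> ends_of ?old. v \<noteq> last p \<and> v \<noteq> hd q}"
      using D(6) mem by auto
    let ?g = "\<lambda>(v, k). (v, pair_to_leaf j k)"
    have "ends_of ?ps = ends_of [(p, set_right (f s) (Leaf j))] \<union> ends_of [(q, set_left (f t) (Touched j))] \<union>
        ends_of (map (\<lambda>(p, s). (p, f s)) ps)"
      by (rule ends_of_pair_Un)
    moreover have "insert (last p, Leaf j) (?g ` {(v, k) \<in> ends_of [(p, s)]. v \<noteq> last p}) \<subseteq>
        {(last p, Leaf j), (hd q, Touched j)} \<union> ?g ` {(v, k) \<in> ends_of ?old. v \<noteq> last p \<and> v \<noteq> hd q}"
      using image_mono[OF 4, of ?g] by (intro insert_subsetI) (auto simp only: Un_iff insert_iff)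
    moreover have "insert (hd q, Touched j) (?g ` {(v, k) \<in> ends_of [(q, t)]. v \<noteq> hd q}) \<subseteq>
        {(last p, Leaf j), (hd q, Touched j)} \<union> ?g ` {(v, k) \<in> ends_of ?old. v \<noteq> last p \<and> v \<noteq> hd q}"
      using image_mono[OF 5, of ?g] by (intro insert_subsetI) (auto simp only: Un_iff insert_iff)
    moreover have "?g ` ends_of ps \<subseteq>
        {(last p, Leaf j), (hd q, Touched j)} \<union> ?g ` {(v, k) \<in> ends_of ?old. v \<noteq> last p \<and> v \<noteq> hd q}"
      using image_mono[OF 6, of ?g] by (rule le_supI2)
    ultimately show ?thesis
      using order_trans[OF 1] order_trans[OF 2] unfolding 3 by (simp only: Un_subset_iff)
  qed
  show "?lab x = ?lab y" if "{x, y} \<in> insert {last p, hd q} (reds h)" for x y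
  proof (cases "{x, y} = {last p, hd q}")
    case True
    then show ?thesis using w(1) by (auto simp: doubleton_eq_iff)
  next
    case False
    then have "{x, y} \<in> reds h" using that by simp
    then show ?thesis using free[of "{x, y}"] realizesD(2)[OF R] by auto
  qed
  have "persistent k \<Longrightarrow> persistent (pair_to_leaf j k)" for k by (cases k) auto
  then have "shape_ok p' s' \<Longrightarrow> shape_ok p' (f s')" for p' s'
    unfolding f_def by (cases s') auto
  then show "shape_ok p' s'" if "(p', s') \<in> set ?ps" for p' s'
    using that realizesD(4)[OF R] shape_ok_set_right[OF sh(1)] shape_ok_set_left[OF sh(2)] kinds
    unfolding f_def by auto
  show "kind_ok ?h ?lab k v" if vk: "(v, k) \<in> ends_of ?ps" for v k
  proof -
    consider "v = last p" "k = Leaf j" | "v = hd q" "k = Touched j"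
      | k0 where "(v, k0) \<in> ends_of ?old" "k = pair_to_leaf j k0" "v \<noteq> last p" "v \<noteq> hd q"
      using subsetD[OF ends vk] by (auto simp del: ends_of_Cons)
    then show ?thesis
    proof cases
      case 1
      have "w \<noteq> last p" using free[OF w(2)] by auto
      then show ?thesis using 1 w(2) by auto
    next
      case 2
      then show ?thesis using w ne by auto
    next
      case 3
      show ?thesis
      proof (cases "k0 = Paired j")
        case True
        have "(hd q, Paired j) \<in> ends_of ?old" using kinds(2) by simp
        then have "{v, hd q} \<in> reds h" using realizesD(7)[OF R, of v j "hd q"] 3 True by simp
        moreover have "{hd q, last p} = {last p, hd q}" by auto
        ultimately have "\<exists>c w. {v, c} \<in> reds ?h \<and> {c, w} \<in> reds ?h \<and> w \<noteq> v"
          using 3(3) by (intro exI[of _ "hd q"] exI[of _ "last p"]) auto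
        then show ?thesis using realizesD(6)[OF R 3(1)] 3 True by auto
      next
        case False
        then have "k = k0" using 3(2) by (cases k0) auto
        then show ?thesis using 3 realizesD(6)[OF R 3(1)] by (intro kind_ok_red) auto
      qed
    qed
  qed
  show "{u, v} \<in> insert {last p, hd q} (reds h)"
    if "(u, Paired i) \<in> ends_of ?ps" "(v, Paired i) \<in> ends_of ?ps" "u \<noteq> v" for u v i
  proof -
    have *: "pair_to_leaf j k = Paired i \<Longrightarrow> k = Paired i" for k by (cases k) (auto split: if_splits)
    have "(u, Paired i) \<in> ends_of ?old" if u: "(u, Paired i) \<in> ends_of ?ps" for u
    proof -
      obtain k where "(u, k) \<in> ends_of ?old" "Paired i = pair_to_leaf j k"
        using subsetD[OF ends u] by (auto simp del: ends_of_Cons)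
      then show ?thesis using *[of k] by simp
    qed
    then show ?thesis using realizesD(7)[OF R _ _ that(3)] that by blast
  qed
  show "map fst ?ps = map fst ?old" by (simp add: comp_def split_beta)
qed

section \<open>Abstract positions\<close>

text \<open>The vertices are hidden, so that a table entry applies to all families with the same
  kinds, whatever the lengths of their paths.\<close>

definition realized :: "history \<Rightarrow> seg list \<Rightarrow> nat \<Rightarrow> bool" where
  "realized h S E \<longleftrightarrow> (\<exists>lab ps. realizes h lab ps \<and> map snd ps = S \<and> edge_count ps = E)"

text \<open>
  Rearrangements of the family that need no round. Steps act on the front of the list, and an inapplicable
  step does nothing (which is always sound). \<open>Join\<close> adds a forced edge between the first two paths.
\<close>

datatype step = Pick nat | Flip | New | Join | Widen | Unpair nat | Relabel "nat list"

fun exec :: "step \<Rightarrow> seg list \<Rightarrow> seg list" where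
  "exec (Pick i) S = (if i < length S then S ! i # take i S @ drop (Suc i) S else S)"
| "exec Flip (s # S) = flip s # S"
| "exec New S = Pnt Free # S"
| "exec Join (s # t # S) =
     (if joinable (right_kind s) (left_kind t) then Seg (left_kind s) (right_kind t) # S else s # t # S)"
| "exec Widen (Pnt k # S) = (if persistent k then Seg k k # S else Pnt k # S)"
| "exec (Unpair i) S = map (map_kinds (unpair i)) S"
| "exec (Relabel ls) S =
     (if list_all (\<lambda>i. list_all (\<lambda>j. ls ! i = ls ! j \<longrightarrow> i = j) (paired_labels S)) (paired_labels S)
      then map (map_kinds (relabel ls)) S else S)"
| "exec _ S = S"

fun gain :: "step \<Rightarrow> seg list \<Rightarrow> nat" where
  "gain Join (s # t # S) = (if joinable (right_kind s) (left_kind t) then 1 else 0)"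
| "gain _ _ = 0"

lemma map_snd_map_kinds: "map snd (map (\<lambda>(p, s). (p, f s)) ps) = map f (map snd ps)"
  by (simp add: comp_def split_beta)

lemma edge_count_map_kinds: "edge_count (map (\<lambda>(p, s). (p, f s)) ps) = edge_count ps"
  by (induction ps) auto

lemma realizedI: "realizes h lab ps \<Longrightarrow> realized h (map snd ps) (edge_count ps)"
  unfolding realized_def by blast

lemma exec_sound:
  assumes "realized h S E"
  shows "realized h (exec a S) (E + gain a S)"
proof -
  obtain lab ps where R: "realizes h lab ps" and S: "map snd ps = S" and E: "edge_count ps = E"
    using assms(1) unfolding realized_def by blast
  show ?thesis
  proof (cases "(a, S)" rule: exec.cases)
    case (1 i S0)
    show ?thesis
    proof (cases "i < length ps")
      case True
      have ps: "ps = take i ps @ ps ! i # drop (Suc i) ps"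
        using True by (rule id_take_nth_drop)
      have r: "realizes h lab (ps ! i # take i ps @ drop (Suc i) ps)"
        using R ps by (metis realizes_pick)
      have m: "map snd (ps ! i # take i ps @ drop (Suc i) ps) = exec a S"
        using 1 True unfolding S[symmetric] by (auto simp: take_map drop_map)
      have c: "edge_count (ps ! i # take i ps @ drop (Suc i) ps) = E"
        unfolding E[symmetric] by (subst (4) ps) (simp add: edge_count_def)
      show ?thesis using realizedI[OF r] 1 unfolding m c by simp
    next
      case False
      then show ?thesis using 1 assms unfolding S[symmetric] by auto
    qed
  next
    case (2 s S0)
    then obtain p ps' where ps: "ps = (p, s) # ps'" "map snd ps' = S0" using S by (cases ps) auto
    show ?thesis
      using realizedI[OF realizes_flip[OF R[unfolded ps(1)]]] 2 ps E by auto
  next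
    case (3 S0)
    obtain v where "realizes h lab (([v], Pnt Free) # ps)" using realizes_new[OF R] by blast
    from realizedI[OF this] show ?thesis using 3 S E by simp
  next
    case (4 s t S0)
    then obtain p q ps' where ps: "ps = (p, s) # (q, t) # ps'" "map snd ps' = S0"
      using S by (cases ps rule: remdups_adj.cases) auto
    show ?thesis
    proof (cases "joinable (right_kind s) (left_kind t)")
      case True
      have "virtual_edge h (last p) (hd q)"
        using virtual_edge_joinable[OF R realizesD(6)[OF R] realizesD(6)[OF R] True] ps(1) by simp
      moreover have "p \<noteq> []" "q \<noteq> []"
        using realizes_disjoint(1,2)[OF R[unfolded ps(1)]] by auto
      then have "edge_count ((p @ q, Seg (left_kind s) (right_kind t)) # ps') = E + 1"
        using E ps(1) by (cases p; cases q) auto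
      ultimately show ?thesis
        using realizedI[OF realizes_join[OF R[unfolded ps(1)]]] True 4 ps(2) by simp
    next
      case False
      then show ?thesis using 4 assms by simp
    qed
  next
    case (5 k S0)
    then obtain p ps' where ps: "ps = (p, Pnt k) # ps'" "map snd ps' = S0" using S by (cases ps) auto
    show ?thesis
      using realizedI[OF realizes_widen[OF R[unfolded ps(1)]]] 5 ps E assms by auto
  next
    case (6 i S0)
    then show ?thesis
      using realizedI[OF realizes_unpair[OF R, of i]]
      unfolding map_snd_map_kinds edge_count_map_kinds S E by auto
  next
    case (7 ls S0)
    have "realized h (map (map_kinds (relabel ls)) S) E"
      if "\<forall>i\<in>set (paired_labels S). \<forall>j\<in>set (paired_labels S). ls ! i = ls ! j \<longrightarrow> i = j"
      using realizedI[OF realizes_relabel[OF R that[folded S]]]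
      unfolding map_snd_map_kinds edge_count_map_kinds S E .
    then show ?thesis using 7 assms by (auto simp: list_all_iff)
  qed (use assms in auto)
qed

fun run :: "step list \<Rightarrow> seg list \<Rightarrow> seg list" where
  "run [] S = S"
| "run (a # as) S = run as (exec a S)"

fun gains :: "step list \<Rightarrow> seg list \<Rightarrow> nat" where
  "gains [] S = 0"
| "gains (a # as) S = gain a S + gains as (exec a S)"

lemma run_sound: "realized h S E \<Longrightarrow> realized h (run as S) (E + gains as S)"
proof (induction as arbitrary: S E)
  case (Cons a as)
  show ?case using Cons.IH[OF exec_sound[OF Cons.prems]] by (simp add: add.assoc)
qed simp

text \<open>The free end ensures that the edge is undrawn. An edge from it to a \<open>Leaf\<close>
  is forced and left to \<open>Join\<close>. The number \<open>i\<close> becomes a label only if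
  both ends are free and the answer is red.\<close>

fun drawable :: "nat \<Rightarrow> seg list \<Rightarrow> bool" where
  "drawable i (s # t # S) \<longleftrightarrow> right_kind s = Free \<and> \<not> is_leaf (left_kind t) \<and> i \<notin> set (paired_labels (s # t # S))"
| "drawable i _ \<longleftrightarrow> False"

fun draw_blue :: "seg list \<Rightarrow> seg list" where
  "draw_blue (s # t # S) = Seg (left_kind s) (right_kind t) # S"
| "draw_blue S = S"

fun recolour :: "nat \<Rightarrow> kind \<Rightarrow> seg \<Rightarrow> seg \<Rightarrow> seg list \<Rightarrow> seg list" where
  "recolour i (Touched j) s t S = set_right s (Leaf j) # t # S"
| "recolour i (Paired j) s t S =
     set_right (map_kinds (pair_to_leaf j) s) (Leaf j) # set_left (map_kinds (pair_to_leaf j) t) (Touched j) #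
     map (map_kinds (pair_to_leaf j)) S"
| "recolour i _ s t S = set_right s (Paired i) # set_left t (Paired i) # S"

fun draw_red :: "nat \<Rightarrow> seg list \<Rightarrow> seg list" where
  "draw_red i (s # t # S) = recolour i (left_kind t) s t S"
| "draw_red i S = S"

lemma draw_sound:
  assumes "realized h S E" "drawable i S"
  shows "\<exists>e. legal_move h e \<and> realized (h @ [(e, Blue)]) (draw_blue S) (E + 1) \<and>
    realized (h @ [(e, Red)]) (draw_red i S) E"
proof -
  obtain lab ps where R: "realizes h lab ps" and S: "map snd ps = S" and E: "edge_count ps = E"
    using assms(1) unfolding realized_def by blast
  obtain s t S0 where st: "S = s # t # S0"
    using assms(2) by (cases "(i, S)" rule: drawable.cases) auto
  then obtain p q ps' where ps: "ps = (p, s) # (q, t) # ps'" "map snd ps' = S0"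
    using S by (cases ps rule: remdups_adj.cases) auto
  have s: "right_kind s = Free" and new: "i \<notin> set (paired_labels (s # t # map snd ps'))"
    and t: "\<not> is_leaf (left_kind t)"
    using assms(2) st ps(2) by auto
  note R' = R[unfolded ps(1)]
  let ?e = "{last p, hd q}"
  have legal: "legal_move h ?e" by (rule realizes_legal_move[OF R' s])
  have "p \<noteq> []" "q \<noteq> []"
    using realizes_disjoint(1,2)[OF R'] by auto
  then have "edge_count ((p @ q, Seg (left_kind s) (right_kind t)) # ps') = E + 1"
    using E ps(1) by (cases p; cases q) auto
  then have blue: "realized (h @ [(?e, Blue)]) (draw_blue S) (E + 1)"
    using realizedI[OF realizes_draw_blue[OF R' legal]] st ps(2) by simp
  have "realized (h @ [(?e, Red)]) (draw_red i S) E"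
  proof (cases "left_kind t")
    case Free
    from realizedI[OF realizes_draw_free_free[OF R' s Free new]] show ?thesis
      using st Free ps E by simp
  next
    case (Touched j)
    from realizedI[OF realizes_draw_free_touched[OF R' s Touched]] show ?thesis
      using st Touched ps E by simp
  next
    case (Paired j)
    let ?f = "map_kinds (pair_to_leaf j)"
    have SR: "draw_red i S = set_right (?f s) (Leaf j) # set_left (?f t) (Touched j) # map ?f S0"
      using st Paired by simp
    have "edge_count ((p, s) # (q, t) # ps') = E" using E ps(1) by simp
    with realizedI[OF realizes_draw_free_paired[OF R' s Paired]] show ?thesis
      unfolding SR list.map snd_conv map_snd_map_kinds ps(2) edge_count_Cons edge_count_map_kinds by simp
  next
    case (Leaf j)
    then show ?thesis using t by simp
  qed
  then show ?thesis using legal blue by blast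
qed

section \<open>Completing a single path\<close>

fun is_seg :: "seg \<Rightarrow> bool" where
  "is_seg (Seg _ _) = True" | "is_seg (Pnt _) = False"

text \<open>Points carry no edges, so with one segment all blue edges lie on one path, whatever
  points remain.\<close>

definition single :: "seg list \<Rightarrow> bool" where
  "single S \<longleftrightarrow> length (filter is_seg S) = 1"

lemma edge_count_points:
  "(\<And>p s. (p, s) \<in> set ps \<Longrightarrow> shape_ok p s) \<Longrightarrow> \<forall>(p, s)\<in>set ps. \<not> is_seg s \<Longrightarrow> edge_count ps = 0"
proof (induction ps)
  case (Cons a ps)
  obtain p s where a: "a = (p, s)" by (cases a)
  then obtain k where "s = Pnt k" using Cons.prems(2) by (cases s) auto
  then have "length p = 1" using Cons.prems(1)[of p s] a by simp
  then show ?case using Cons a by simp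
qed (simp add: edge_count_def)

lemma edge_count_append [simp]: "edge_count (ps @ qs) = edge_count ps + edge_count qs"
  by (simp add: edge_count_def)

text \<open>Every blue edge belongs to the one path, so the edges still to be drawn and the blue
  ones add up to \<open>l\<close>; the red edges are the only extra cost.\<close>

lemma wins_if_single:
  assumes "realized h S l" "single S" "l + card (reds h) \<le> N"
  shows "wins (path_graph 4) (path_graph (l + 1)) N h"
proof -
  obtain lab ps where R: "realizes h lab ps" and S: "map snd ps = S" and E: "edge_count ps = l"
    using assms(1) unfolding realized_def by blast
  have "length (filter (is_seg \<circ> snd) ps) = 1"
    using assms(2) S unfolding single_def by (metis filter_map length_map)
  then obtain a where "filter (is_seg \<circ> snd) ps = [a]" by (auto simp: length_Suc_conv)
  then obtain us vs where ps: "ps = us @ a # vs" "\<forall>u\<in>set us. \<not> is_seg (snd u)" "filter (is_seg \<circ> snd) vs = []"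
    by (auto simp: filter_eq_Cons_iff)
  obtain p s where a: "a = (p, s)" by (cases a)
  have points: "\<forall>(p, s)\<in>set (us @ vs). \<not> is_seg s"
    using ps(2,3) by (auto simp: filter_empty_conv)
  have shapes: "shape_ok p s" if "(p, s) \<in> set ps" for p s
    using realizesD(4)[OF R that] by simp
  have "edge_count (us @ vs) = 0"
    using points shapes ps(1) by (intro edge_count_points) auto
  then have len: "length p = Suc l"
    using E ps(1) a shapes[of p s] shape_ok_nonempty[of p s] by (cases p) auto
  have no_edges: "path_edges q = {}" if q: "(q, t) \<in> set (us @ vs)" for q t
  proof -
    obtain k where "t = Pnt k" using bspec[OF points q] by (cases t) auto
    then have "length q = 1" using shapes[of q t] ps(1) q by auto
    then show ?thesis by (auto simp: length_Suc_conv)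
  qed
  have "blues h \<subseteq> path_edges p"
  proof
    fix e assume "e \<in> blues h"
    then obtain q t where q: "(q, t) \<in> set ps" "e \<in> path_edges q"
      using realizesD(5)[OF R] by auto
    have "(q, t) \<notin> set (us @ vs)" using no_edges[of q t] q(2) by auto
    then have "(q, t) = (p, s)" using q(1) ps(1) a by auto
    then show "e \<in> path_edges p" using q(2) by simp
  qed
  moreover have "distinct p" using realizesD(3)[OF R] ps(1) a by simp
  moreover from this have "card (path_edges p) = l" using card_path_edges len by fastforce
  ultimately have "card (path_edges p - blues h) = l - card (blues h)" "card (blues h) \<le> l"
    using card_mono[of "path_edges p" "blues h"] by (auto simp: card_Diff_subset)
  then have "length h + card (path_edges p - blues h) \<le> N"
    using legal_history_length[OF realizesD(1)[OF R]] assms(3) by simp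
  moreover have "successively (virtual_edge h) p" using realizesD(4)[OF R, of p s] ps(1) a by simp
  ultimately show ?thesis
    using wins_if_virtual_path[OF \<open>distinct p\<close> len _ realizesD(1)[OF R]] by blast
qed

text \<open>This turns the bounds of a position into a bound on the rounds played, from which the
  termination of Builder's strategy follows.\<close>

lemma length_le_edge_count:
  assumes "realized h S E"
  shows "length h \<le> card (reds h) + E"
proof -
  obtain lab ps where R: "realizes h lab ps" and E: "edge_count ps = E"
    using assms(1) unfolding realized_def by blast
  have "card (\<Union>p\<in>fst ` set ps. path_edges p) \<le> edge_count ps" if "distinct (concat (map fst ps))" for ps :: "(nat list \<times> seg) list"
    using that
  proof (induction ps)
    case (Cons a ps)
    obtain p s where a: "a = (p, s)" by (cases a)
    have "card (\<Union>p\<in>fst ` set (a # ps). path_edges p) \<le> card (path_edges p) + card (\<Union>p\<in>fst ` set ps. path_edges p)"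
      using card_Un_le a by auto
    then show ?case using Cons a card_path_edges[of p] by simp
  qed simp
  then have "card (\<Union>p\<in>fst ` set ps. path_edges p) \<le> E" using realizesD(3)[OF R] E by auto
  then have "card (blues h) \<le> E"
    using card_mono[OF _ realizesD(5)[OF R]] by fastforce
  then show ?thesis using legal_history_length[OF realizesD(1)[OF R]] by simp
qed

text \<open>
  A position \<open>(S, v, d)\<close> promises that Builder wins if \<open>v \<le> 2 E - 5 R\<close> and \<open>E \<le> l - 1 + d\<close>. The second bound keeps
  Builder from overshooting: paths cannot be shortened without wasting blue edges.
\<close>

type_synonym position = "seg list \<times> int \<times> int"
type_synonym branch = "step list list \<times> step list \<times> position"

text \<open>
  If the steps lead to a single path with \<open>E + i\<close> edges, Builder is done when \<open>l = E + i\<close>, so that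
  \<open>l \<ge> E + i\<close> may be sharpened to \<open>l \<ge> E + i + 1\<close>.
\<close>

definition cover_step :: "seg list \<Rightarrow> int \<Rightarrow> nat \<Rightarrow> int \<Rightarrow> int" where
  "cover_step S v i d = (if single S \<and> int i = 1 - d \<and> -6 \<le> v + 2 * int i then d - 1 else d)"

text \<open>The steps are only imagined: the position and \<open>E\<close> stay as they are, while
  \<open>i\<close> counts the forced edges that the completion would use. Every position on the way
  is tested, so one list can serve several values of \<open>l\<close>.\<close>

fun cover :: "seg list \<Rightarrow> int \<Rightarrow> nat \<Rightarrow> step list \<Rightarrow> int \<Rightarrow> int" where
  "cover S v i [] d = cover_step S v i d"
| "cover S v i (a # as) d = cover (exec a S) v (i + gain a S) as (cover_step S v i d)"

text \<open>The covers are tried in turn before \<open>as\<close> is carried out; each success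
  lowers \<open>d\<close> and so lets a longer completion count. The inequalities for
  \<open>v'\<close> and \<open>d'\<close> allow surplus to be given away, which is how play returns
  to finitely many entries.\<close>

fun check_branch :: "seg list \<Rightarrow> int \<Rightarrow> int \<Rightarrow> branch \<Rightarrow> bool" where
  "check_branch S v d (covers, as, T, v', d') \<longleftrightarrow>
     run as S = T \<and> v' \<le> v + 2 * int (gains as S) \<and>
     fold (cover S v 0) covers d + int (gains as S) \<le> d'"

text \<open>The preparing steps must not commit forced edges, as \<open>v\<close> and
  \<open>d\<close> are not adjusted for them. The numbers -100 and 10 are generous; any fixed bounds
  would make the play finite.\<close>

fun check_node :: "position \<times> step list \<times> nat \<times> branch \<times> branch \<Rightarrow> bool" where
  "check_node ((S, v, d), as, i, blue, red) \<longleftrightarrow>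
     -100 \<le> v \<and> d \<le> 10 \<and> gains as S = 0 \<and> drawable i (run as S) \<and>
     check_branch (draw_blue (run as S)) (v + 2) (d + 1) blue \<and>
     check_branch (draw_red i (run as S)) (v - 5) d red"

section \<open>Soundness of the check\<close>

definition admissible :: "nat \<Rightarrow> history \<Rightarrow> nat \<Rightarrow> int \<Rightarrow> int \<Rightarrow> bool" where
  "admissible l h E v d \<longleftrightarrow> v \<le> 2 * int E - 5 * int (card (reds h)) \<and> int E \<le> int l - 1 + d"

abbreviation wins_path :: "nat \<Rightarrow> history \<Rightarrow> bool" where
  "wins_path l \<equiv> wins (path_graph 4) (path_graph (l + 1)) (l + (2 * l + 6) div 5)"

text \<open>For \<open>i = 1 - d\<close> the bound on \<open>E\<close> reads
  \<open>E + i \<le> l\<close>. In case of equality the completed path has \<open>l\<close> edges,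
  and -6 is the threshold at which \<open>5 R \<le> 2 l + 6\<close>, as the round limit demands;
  otherwise the inequality is strict.\<close>

lemma cover_step_sound:
  assumes "realized h S (E + i)" "admissible l h E v d"
  shows "wins_path l h \<or> admissible l h E v (cover_step S v i d)"
proof (cases "single S \<and> int i = 1 - d \<and> -6 \<le> v + 2 * int i \<and> l = E + i")
  case True
  then have "5 * card (reds h) \<le> 2 * l + 6"
    using assms(2) unfolding admissible_def by linarith
  then have "l + card (reds h) \<le> l + (2 * l + 6) div 5" by linarith
  then show ?thesis using wins_if_single[of h S l] assms(1) True by blast
next
  case False
  then show ?thesis using assms(2) unfolding admissible_def cover_step_def by (auto split: if_splits)
qed

lemma cover_sound:
  "realized h S (E + i) \<Longrightarrow> admissible l h E v d \<Longrightarrow>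
     wins_path l h \<or> admissible l h E v (cover S v i as d)"
proof (induction as arbitrary: S i d)
  case Nil
  then show ?case using cover_step_sound[of h S E i l v d] by simp
next
  case (Cons a as)
  have "realized h (exec a S) (E + (i + gain a S))"
    using exec_sound[OF Cons.prems(1)] by (simp add: add.assoc)
  then show ?case using Cons.IH cover_step_sound[OF Cons.prems] by auto
qed

lemma fold_cover_sound:
  "realized h S E \<Longrightarrow> admissible l h E v d \<Longrightarrow>
     wins_path l h \<or> admissible l h E v (fold (cover S v 0) covers d)"
proof (induction covers arbitrary: d)
  case (Cons as covers)
  then show ?case using cover_sound[of h S E 0 l v d as] by auto
qed simp

lemma check_branch_sound:
  assumes "check_branch S v d (covers, as, T, v', d')" "realized h S E" "admissible l h E v d"
    and "\<And>E. realized h T E \<Longrightarrow> admissible l h E v' d' \<Longrightarrow> wins_path l h"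
  shows "wins_path l h"
proof -
  let ?d = "fold (cover S v 0) covers d"
  let ?j = "gains as S"
  have run: "run as S = T" and le: "v' \<le> v + 2 * int ?j" "?d + int ?j \<le> d'"
    using assms(1) by auto
  consider "wins_path l h" | "admissible l h E v ?d"
    using fold_cover_sound[OF assms(2,3)] by blast
  then show ?thesis
  proof cases
    case 2
    then have "admissible l h (E + ?j) v' d'"
      using le unfolding admissible_def by auto
    then show ?thesis using assms(4) run_sound[OF assms(2), of as] run by simp
  qed
qed

text \<open>No entry is final: within the table Builder's win always comes from a cover. The
  induction is on the rounds that remain before \<open>2 * l + 100\<close>; it succeeds because
  admissible positions cannot occur that late, so play cannot stay in the table.\<close>

theorem check_sound:
  assumes "\<And>n. n \<in> set tbl \<Longrightarrow> check_node n"
    and "\<And>q as i cB aB B cR aR R. (q, as, i, (cB, aB, B), (cR, aR, R)) \<in> set tbl \<Longrightarrow> {B, R} \<subseteq> fst ` set tbl"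
    and "(S, v, d) \<in> fst ` set tbl" "realized h S E" "admissible l h E v d"
  shows "wins_path l h"
  using assms(3-5)
proof (induction "2 * l + 100 - length h" arbitrary: h S E v d rule: less_induct)
  case less
  obtain as i cB aB B cR aR R where node: "((S, v, d), as, i, (cB, aB, B), (cR, aR, R)) \<in> set tbl"
    using less.prems(1) by force
  obtain TB vB dB TR vR dR where BR: "B = (TB, vB, dB)" "R = (TR, vR, dR)"
    by (cases B; cases R)
  have closed: "(TB, vB, dB) \<in> fst ` set tbl" "(TR, vR, dR) \<in> fst ` set tbl"
    using assms(2)[OF node] BR by auto
  let ?S = "run as S"
  have bounds: "-100 \<le> v" "d \<le> 10" and gains: "gains as S = 0" and draw: "drawable i ?S"
    and blue: "check_branch (draw_blue ?S) (v + 2) (d + 1) (cB, aB, TB, vB, dB)"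
    and red: "check_branch (draw_red i ?S) (v - 5) d (cR, aR, TR, vR, dR)"
    using assms(1)[OF node] BR by auto
  obtain e where e: "legal_move h e" "realized (h @ [(e, Blue)]) (draw_blue ?S) (E + 1)"
    "realized (h @ [(e, Red)]) (draw_red i ?S) E"
    using draw_sound[OF run_sound[OF less.prems(2)] draw] gains by auto
  \<comment> \<open>The bounds give \<open>E \<le> l + 9\<close> and
    \<open>5 R \<le> 2 E + 100\<close>, hence R + E is below \<open>2 * l + 100\<close>.\<close>
  have "length h < 2 * l + 100"
    using length_le_edge_count[OF less.prems(2)] less.prems(3) bounds unfolding admissible_def by linarith
  then have shorter: "2 * l + 100 - length (h @ [(e, c)]) < 2 * l + 100 - length h" for c
    by simp
  have "e \<notin> reds h" using e(1) reds_Un_blues[of h] unfolding legal_move_def by blast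
  then have adm: "admissible l (h @ [(e, Blue)]) (E + 1) (v + 2) (d + 1)" "admissible l (h @ [(e, Red)]) E (v - 5) d"
    using less.prems(3) unfolding admissible_def by auto
  have "wins_path l (h @ [(e, Blue)])"
    using check_branch_sound[OF blue e(2) adm(1)] less.hyps[OF shorter closed(1)] by blast
  moreover have "wins_path l (h @ [(e, Red)])"
    using check_branch_sound[OF red e(3) adm(2)] less.hyps[OF shorter closed(2)] by blast
  ultimately have "wins_path l (h @ [(e, c)])" for c
    by (cases c) auto
  then show ?case using e(1) by (rule wins.move[rotated])
qed

section \<open>The strategy table\<close>

text \<open>
  Found by solving the energy game on such positions by computer. An entry consists of a position, the steps
  that bring the ends of the next edge to the front, a label for them, and for either colour the step lists
  to be used as in \<open>cover\<close>, the steps towards the next position, and that position.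
\<close>

definition strategy :: "(position \<times> step list \<times> nat \<times> branch \<times> branch) list" where
  "strategy = [
    (([], 0, -2), [New, New], 0, ([], [], ([Seg Free Free], 2, -1)), ([], [Pick 1, Pick 1], ([Pnt (Paired 0),
      Pnt (Paired 0)], -5, -2))),
    (([Seg Free Free], 2, -1), [New, Pick 1], 0, ([], [], ([Seg Free Free], 3, 0)), ([], [Pick 1, Pick 1],
      ([Seg Free (Paired 0), Pnt (Paired 0)], -3, -1))),
    (([Pnt (Paired 0), Pnt (Paired 0)], -5, -2), [New], 1, ([], [Pick 1, Pick 1], ([Seg Free (Paired 0), Pnt
      (Paired 0)], -3, -1)), ([[New, Pick 1, Pick 1, Join, New, Pick 1, Join, Pick 2, Pick 1, Join, New, Pick
      1, Join]], [New, Pick 3, Join, Flip, Pick 1, Join, Pick 1], ([Pnt (Touched 0), Seg (Leaf 0) (Leaf 0)],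
      -6, -2))),
    (([Seg Free Free], 3, 0), [New, Pick 1], 0, ([[]], [], ([Seg Free Free], 3, 0)), ([], [Pick 1, Pick 1],
      ([Seg Free (Paired 0), Pnt (Paired 0)], -2, 0))),
    (([Seg Free (Paired 0), Pnt (Paired 0)], -3, -1), [New, New], 1, ([], [Pick 2, Pick 2, Pick 2], ([Seg Free
      Free, Seg Free (Paired 0), Pnt (Paired 0)], -1, 0)), ([[Pick 2, Flip, Pick 2, Join, Pick 2, Join, Pick
      1, Join]], [Pick 3, Pick 2, Pick 2, Pick 3], ([Seg Free (Paired 0), Pnt (Paired 1), Pnt (Paired 1), Pnt
      (Paired 0)], -9, -3))),
    (([Pnt (Touched 0), Seg (Leaf 0) (Leaf 0)], -6, -2), [New, New], 1, ([[Pick 2, Pick 1, Join, New, Pick 1,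
      Join]], [Pick 2, Pick 2], ([Pnt (Touched 0), Seg (Leaf 0) (Leaf 0), Seg Free Free], -5, -2)), ([[Pick 3,
      New, Pick 1, Join, Pick 2, Join, Pick 2, Join, Pick 1, Join]], [Pick 1, Pick 1, Pick 3, Pick 3], ([Pnt
      (Touched 0), Seg (Leaf 0) (Leaf 0), Pnt (Paired 1), Pnt (Paired 1)], -11, -4))),
    (([Seg Free (Paired 0), Pnt (Paired 0)], -2, 0), [New, Pick 1, Flip], 1, ([[]], [Pick 1, Pick 1, Flip],
      ([Seg Free (Paired 0), Pnt (Paired 0)], -2, 0)), ([[Pick 2, Pick 1, Join, Pick 1, Pick 1, Join]], [Pick
      2, Pick 2, Relabel [1, 0]], ([Pnt (Paired 0), Pnt (Paired 1), Seg (Paired 1) (Paired 0)], -7, -2))),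
    (([Seg Free Free, Seg Free (Paired 0), Pnt (Paired 0)], -1, 0), [Pick 1, Pick 1], 1, ([[]], [Pick 1, Pick
      1], ([Seg Free (Paired 0), Pnt (Paired 0)], -2, 0)), ([[Pick 1, Flip, Pick 1, Join, Pick 1, Pick 1,
      Join]], [Pick 1, Pick 2, Pick 2, Relabel [1, 0]], ([Seg Free (Paired 0), Pnt (Paired 1), Seg (Paired 0)
      (Paired 1)], -6, -2))),
    (([Seg Free (Paired 0), Pnt (Paired 1), Pnt (Paired 1), Pnt (Paired 0)], -9, -3), [Pick 1, New], 2,
      ([[Pick 3, Pick 1, Join, Pick 2, Pick 1, Join, Pick 1, Flip, Pick 1, Join]], [Pick 3, Pick 3, Pick 3,
      Pick 3, Relabel [1, 0]], ([Seg Free (Paired 0), Seg Free (Paired 1), Pnt (Paired 0), Pnt (Paired 1)],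
      -7, -3)), ([[Pick 2, Pick 2, Pick 1, Join, Pick 3, Pick 1, Join, Pick 1, Pick 1, Join, New, Pick 1,
      Join, Pick 1, Pick 1, Join, New, Pick 1, Join]], [New, Pick 4, Join, Pick 3, Flip, Join, Pick 2, Join,
      Unpair 0, Pick 1, Pick 2], ([Pnt (Touched 0), Pnt (Leaf 1), Seg (Touched 1) Free], -8, -3))),
    (([Pnt (Touched 0), Seg (Leaf 0) (Leaf 0), Seg Free Free], -5, -2), [New, Pick 3], 1, ([[Pick 2, Pick 1,
      Join, New, Pick 1, Join]], [Pick 2, Pick 2], ([Pnt (Touched 0), Seg (Leaf 0) (Leaf 0), Seg Free Free],
      -5, -2)), ([[Flip, Pick 3, Pick 1, Join, New, Pick 1, Join, Pick 2, Join, Pick 1, Join]], [Unpair 1,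
      Pick 1, Pick 2, Join, Pick 1, Pick 2, Pick 2], ([Seg (Touched 0) (Touched 1), Seg (Leaf 0) (Leaf 0), Seg
      Free (Touched 1)], -8, -3))),
    (([Pnt (Touched 0), Seg (Leaf 0) (Leaf 0), Pnt (Paired 1), Pnt (Paired 1)], -11, -4), [Pick 2, New], 2,
      ([[Flip, Pick 2, Pick 1, Join, New, Pick 1, Join, Pick 1, Join, Pick 1, Join]], [Unpair 1, Pick 1, Pick
      3, Join, Pick 1, Pick 2, Pick 2, Flip], ([Seg (Touched 0) (Touched 1), Seg (Leaf 0) (Leaf 0), Seg Free
      (Touched 1)], -8, -3)), ([[Pick 3, New, Pick 1, Join, Pick 4, Pick 1, Join, New, Pick 1, Join, New,
      Join, Pick 1, Join, Pick 2, Join, Pick 1, Join]], [New, Pick 5, Join, Flip, Pick 4, Flip, Join, Pick 2,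
      Pick 3, Join, New, Pick 3, Join, Flip, Pick 2, Join, Pick 1], ([Seg (Touched 0) (Touched 1), Seg (Leaf
      0) (Leaf 1)], -6, -2))),
    (([Pnt (Paired 0), Pnt (Paired 1), Seg (Paired 1) (Paired 0)], -7, -2), [Pick 2, New], 2, ([[Pick 2, Pick
      1, Join, Pick 1, Pick 1, Join]], [Pick 2, Pick 2, Pick 2, Unpair 1], ([Seg Free (Paired 0), Pnt (Paired
      0), Pnt (Touched 1)], -5, -2)), ([[Pick 1, Flip, Pick 2, Pick 1, Join, Pick 1, Pick 1, Join, New, Pick
      1, Join, Pick 1, Pick 1, Join, New, Pick 1, Join]], [New, Pick 4, Join, Flip, Pick 1, Join, Pick 1, Pick
      2, Pick 2, Relabel [1, 0]], ([Seg (Leaf 0) (Leaf 0), Pnt (Paired 1), Seg (Touched 0) (Paired 1)], -9,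
      -3))),
    (([Seg Free (Paired 0), Pnt (Paired 1), Seg (Paired 0) (Paired 1)], -6, -2), [Pick 2, New], 2, ([], [Pick
      2, Pick 2, Pick 2, Unpair 0, Relabel [1, 0]], ([Seg Free (Paired 0), Seg Free (Touched 1), Pnt (Paired
      0)], -4, -1)), ([[Pick 2, Pick 2, Flip, Pick 1, Join, Pick 2, Pick 1, Join, Pick 1, Pick 1, Join, New,
      Pick 1, Join]], [Pick 2, Flip, Join, Pick 1, Pick 2, Pick 2], ([Seg (Leaf 0) (Leaf 0), Pnt (Paired 1),
      Seg (Touched 0) (Paired 1)], -9, -3))),
    (([Seg Free (Paired 0), Seg Free (Paired 1), Pnt (Paired 0), Pnt (Paired 1)], -7, -3), [Pick 2, New], 2,
      ([], [Pick 3, Pick 3, Pick 3, Pick 3], ([Seg Free (Paired 0), Seg Free (Paired 0), Seg Free (Paired 1),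
      Pnt (Paired 1)], -5, -2)), ([[Pick 2, Pick 3, Pick 1, Join, Pick 2, Pick 1, Join, Pick 2, Pick 1, Join,
      Pick 1, Pick 1, Join, New, Pick 1, Join]], [Pick 2, Flip, Pick 3, Flip, Join, Pick 2, Join, Unpair 1,
      Pick 1, Pick 2, Relabel [1, 0]], ([Pnt (Touched 0), Pnt (Leaf 1), Seg (Touched 1) Free], -8, -3))),
    (([Pnt (Touched 0), Pnt (Leaf 1), Seg (Touched 1) Free], -8, -3), [New, New], 2, ([[Pick 2, Pick 1, Join,
      Pick 2, Flip, Pick 1, Join, Pick 1, Pick 1, Join]], [Pick 3, Pick 1, Pick 3, Pick 3], ([Pnt (Touched 0),
      Pnt (Leaf 1), Seg Free Free, Seg (Touched 1) Free], -7, -3)), ([[Pick 4, Pick 4, Pick 1, Join, New, Pick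
      1, Join, Pick 2, Join, Pick 2, Join, Pick 1, Join]], [Pick 4, Pick 2, Pick 2, Pick 4, Pick 4], ([Pnt
      (Touched 0), Pnt (Leaf 1), Pnt (Paired 2), Pnt (Paired 2), Seg (Touched 1) Free], -13, -5))),
    (([Seg (Touched 0) (Touched 1), Seg (Leaf 0) (Leaf 0), Seg Free (Touched 1)], -8, -3), [New, New], 2,
      ([[Pick 2, Pick 1, Join, Pick 1, Flip, Pick 1, Join, Pick 1, Flip, Pick 1, Join]], [Pick 3, Pick 1, Pick
      3, Pick 3], ([Seg (Touched 0) (Touched 1), Seg (Leaf 0) (Leaf 0), Seg Free Free, Seg Free (Touched 1)],
      -7, -3)), ([[Pick 2, Pick 2, Pick 1, Join, Pick 3, Flip, Pick 1, Join, Pick 2, Pick 1, Join, New, Pick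
      1, Join, Pick 1, Join]], [Pick 1, Pick 1, Pick 4, Pick 4, Pick 4], ([Seg (Touched 0) (Touched 1), Seg
      (Leaf 0) (Leaf 0), Seg Free (Touched 1), Pnt (Paired 2), Pnt (Paired 2)], -13, -5))),
    (([Seg (Touched 0) (Touched 1), Seg (Leaf 0) (Leaf 1)], -6, -2), [New, New], 2, ([[Pick 2, Pick 1, Join,
      Pick 1, Pick 1, Join]], [Pick 2, Pick 2], ([Seg (Touched 0) (Touched 1), Seg (Leaf 0) (Leaf 1), Seg Free
      Free], -5, -2)), ([[Pick 2, Pick 2, Pick 1, Join, Pick 2, Pick 1, Join, New, Pick 1, Join, Pick 1,
      Join]], [Pick 1, Pick 1, Pick 3, Pick 3], ([Seg (Touched 0) (Touched 1), Seg (Leaf 0) (Leaf 1), Pnt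
      (Paired 2), Pnt (Paired 2)], -11, -4))),
    (([Seg Free (Paired 0), Pnt (Paired 0), Pnt (Touched 1)], -5, -2), [Pick 2, New], 2, ([], [Pick 2, Pick 1,
      Pick 2], ([Seg Free (Paired 0), Seg Free (Touched 1), Pnt (Paired 0)], -4, -1)), ([[Pick 2, Pick 2, Pick
      1, Join, Pick 2, Pick 1, Join, Pick 1, Pick 1, Join, New, Pick 1, Join]], [Pick 1, Pick 2, Join, Unpair
      0, Flip, Pick 1, Pick 2], ([Pnt (Touched 0), Pnt (Leaf 1), Seg (Touched 1) Free], -8, -3))),
    (([Seg (Leaf 0) (Leaf 0), Pnt (Paired 1), Seg (Touched 0) (Paired 1)], -9, -3), [Pick 2, Flip, New], 2,
      ([[Flip, Pick 1, Pick 1, Join, New, Pick 1, Join, Pick 1, Join]], [Unpair 1, Pick 1, Pick 2, Relabel [1,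
      0]], ([Pnt (Touched 0), Seg (Leaf 1) (Leaf 1), Seg Free (Touched 1)], -8, -3)), ([[Pick 1, Flip, Pick 2,
      Pick 1, Join, New, Pick 1, Join, Pick 1, Pick 1, Join, New, Pick 1, Join, Pick 1, Pick 1, Join, New,
      Pick 1, Join]], [New, Pick 4, Join, Flip, Pick 3, Flip, Join, New, Pick 2, Join, Flip, Pick 1, Flip,
      Join, Pick 1, Pick 1, Relabel [1, 0]], ([Seg (Leaf 0) (Leaf 0), Seg (Touched 0) (Touched 1)], -6, -2))),
    (([Seg Free (Paired 0), Seg Free (Touched 1), Pnt (Paired 0)], -4, -1), [New, Pick 1, Flip], 2, ([[Flip,
      Pick 1, Flip, Pick 1, Join]], [Pick 2, Pick 2, Pick 2, Flip], ([Seg Free (Paired 0), Seg Free (Touched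
      1), Pnt (Paired 0)], -4, -1)), ([[Flip, Pick 2, Flip, Pick 1, Join, Pick 2, Join, Pick 1, Join]], [Pick
      3, Pick 2, Pick 3, Relabel [2, 0, 1]], ([Seg Free (Touched 0), Pnt (Paired 1), Pnt (Paired 2), Seg
      (Paired 2) (Paired 1)], -9, -3))),
    (([Seg Free (Paired 0), Seg Free (Paired 0), Seg Free (Paired 1), Pnt (Paired 1)], -5, -2), [Pick 3, Pick
      3, Flip], 2, ([[Pick 1, Pick 1, Pick 1, Join, Pick 1, Flip, Pick 1, Join]], [Flip, Pick 2, Join, Pick 1,
      Pick 1, Unpair 0, Unpair 1, Relabel [1, 0]], ([Seg Free (Touched 0), Seg Free (Touched 1)], -1, -1)),
      ([[Pick 2, Pick 2, Pick 1, Join, Pick 2, Flip, Pick 1, Join, Pick 1, Pick 1, Join, New, Pick 1, Join]],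
      [Unpair 0, Pick 3, Pick 3, Pick 2, Pick 3, Relabel [1, 0]], ([Pnt (Touched 0), Seg (Leaf 0) (Leaf 0),
      Seg Free (Touched 1), Seg Free (Touched 1)], -10, -4))),
    (([Pnt (Touched 0), Pnt (Leaf 1), Seg Free Free, Seg (Touched 1) Free], -7, -3), [New, Pick 3], 2, ([[Pick
      2, Pick 1, Join, Pick 2, Flip, Pick 1, Join, Pick 1, Pick 1, Join]], [Pick 3, Pick 1, Pick 3, Pick 3],
      ([Pnt (Touched 0), Pnt (Leaf 1), Seg Free Free, Seg (Touched 1) Free], -7, -3)), ([[Pick 2, Pick 1,
      Join, Pick 1, Pick 1, Join, Pick 2, Pick 1, Join, Pick 1, Pick 1, Join, New, Pick 1, Join]], [Pick 1,
      Pick 4, Flip, Join, Unpair 2, Pick 1, Pick 1, Pick 3, Widen, Pick 3, Relabel [0, 0, 1]], ([Pnt (Touched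
      0), Seg (Leaf 0) (Leaf 0), Seg Free (Touched 1), Seg Free (Touched 1)], -10, -4))),
    (([Pnt (Touched 0), Pnt (Leaf 1), Pnt (Paired 2), Pnt (Paired 2), Seg (Touched 1) Free], -13, -5), [Pick
      2, New], 3, ([[Pick 1, Pick 1, Join, Pick 2, Pick 1, Join, Pick 2, Pick 1, Join, Pick 1, Pick 1, Join,
      New, Pick 1, Join]], [Pick 3, Pick 4, Flip, Join, Unpair 2, Pick 1, Pick 1, Pick 3, Widen, Pick 3,
      Relabel [0, 0, 1]], ([Pnt (Touched 0), Seg (Leaf 0) (Leaf 0), Seg Free (Touched 1), Seg Free (Touched
      1)], -10, -4)), ([[Pick 5, Pick 1, Pick 1, Join, New, Pick 1, Join, Pick 3, Pick 1, Join, New, Pick 1,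
      Join, Pick 3, Pick 1, Join, New, Pick 1, Join, Pick 2, Join, Pick 1, Join]], [New, Pick 5, Join, Pick 5,
      Join, New, Pick 5, Join, Flip, Pick 2, Join, Pick 1, Pick 2, Join, Flip, Pick 1, Pick 2, Relabel [0, 1,
      1]], ([Pnt (Touched 0), Seg (Leaf 1) (Leaf 1), Seg Free (Touched 1)], -8, -3))),
    (([Seg (Touched 0) (Touched 1), Seg (Leaf 0) (Leaf 0), Seg Free Free, Seg Free (Touched 1)], -7, -3),
      [New, Pick 3], 2, ([[Pick 2, Pick 1, Join, Pick 1, Flip, Pick 1, Join, Pick 1, Flip, Pick 1, Join]],
      [Pick 3, Pick 1, Pick 3, Pick 3], ([Seg (Touched 0) (Touched 1), Seg (Leaf 0) (Leaf 0), Seg Free Free,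
      Seg Free (Touched 1)], -7, -3)), ([[Pick 2, Pick 1, Join, Pick 1, Pick 1, Join, Pick 2, Flip, Pick 1,
      Join, Pick 1, Pick 1, Join, New, Pick 1, Join]], [Pick 1, Pick 4, Join, Unpair 2, Pick 1, Pick 1, Pick
      3, Pick 3], ([Seg (Touched 0) (Touched 1), Seg (Leaf 0) (Leaf 0), Seg Free (Touched 2), Seg Free
      (Touched 2)], -10, -4))),
    (([Seg (Touched 0) (Touched 1), Seg (Leaf 0) (Leaf 0), Seg Free (Touched 1), Pnt (Paired 2), Pnt (Paired
      2)], -13, -5), [Pick 3, New], 3, ([[Pick 1, Pick 1, Join, Pick 3, Pick 1, Join, Pick 2, Flip, Pick 1,
      Join, Pick 1, Pick 1, Join, New, Pick 1, Join]], [Pick 3, Flip, Pick 4, Join, Unpair 2, Pick 1, Pick 1,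
      Flip, Pick 3, Pick 3], ([Seg (Touched 0) (Touched 1), Seg (Leaf 0) (Leaf 0), Seg Free (Touched 2), Seg
      Free (Touched 2)], -10, -4)), ([[Pick 2, Flip, Pick 4, Flip, Pick 1, Join, Pick 3, Pick 1, Join, New,
      Pick 1, Join, Pick 1, Pick 1, Join, New, Pick 1, Join, Pick 2, Pick 1, Join, New, Pick 1, Join, Pick 1,
      Join]], [New, Pick 6, Join, Pick 5, Flip, Join, New, Pick 5, Flip, Join, Flip, Pick 2, Join, Pick 2,
      Pick 3, Flip, Join, Pick 2, Flip, Pick 2, Pick 2, Flip, Relabel [0, 1, 0]], ([Seg (Touched 0) (Touched
      1), Seg (Leaf 0) (Leaf 0), Seg Free (Touched 1)], -8, -3))),
    (([Seg (Touched 0) (Touched 1), Seg (Leaf 0) (Leaf 1), Seg Free Free], -5, -2), [New, Pick 3], 2, ([[Pick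
      2, Pick 1, Join, Pick 1, Pick 1, Join]], [Pick 2, Pick 2], ([Seg (Touched 0) (Touched 1), Seg (Leaf 0)
      (Leaf 1), Seg Free Free], -5, -2)), ([[Pick 2, Pick 1, Flip, Pick 1, Join, Pick 2, Pick 1, Join, New,
      Pick 1, Join, Pick 1, Join]], [Unpair 2, Pick 1, Pick 2, Flip, Join, Pick 1, Pick 2, Pick 2, Relabel [0,
      0, 1]], ([Seg (Touched 0) (Touched 1), Seg (Leaf 0) (Leaf 0), Seg Free (Touched 1)], -8, -3))),
    (([Seg (Touched 0) (Touched 1), Seg (Leaf 0) (Leaf 1), Pnt (Paired 2), Pnt (Paired 2)], -11, -4), [Pick 2,
      New], 3, ([[Pick 1, Pick 1, Flip, Pick 1, Join, Pick 1, Pick 1, Join, New, Pick 1, Join, Pick 1, Join]],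
      [Unpair 2, Pick 1, Flip, Pick 3, Join, Pick 1, Pick 2, Pick 2, Flip, Relabel [0, 0, 1]], ([Seg (Touched
      0) (Touched 1), Seg (Leaf 0) (Leaf 0), Seg Free (Touched 1)], -8, -3)), ([[Pick 2, Pick 3, Pick 1, Join,
      New, Pick 1, Join, Pick 1, Pick 1, Join, New, Pick 1, Join, Pick 2, Pick 1, Join, New, Pick 1, Join,
      Pick 1, Join]], [New, Pick 5, Join, Flip, Pick 4, Flip, Join, Pick 2, Pick 3, Flip, Join, New, Pick 3,
      Join, Flip, Pick 2, Join, Pick 1, Relabel [0, 0, 1]], ([Seg (Touched 0) (Touched 1), Seg (Leaf 0) (Leaf
      1)], -6, -2))),
    (([Pnt (Touched 0), Seg (Leaf 1) (Leaf 1), Seg Free (Touched 1)], -8, -3), [New, New], 2, ([[Pick 2, Pick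
      1, Join, Pick 2, Pick 1, Join, Pick 1, Pick 1, Join]], [Pick 3, Pick 1, Pick 3, Pick 3], ([Pnt (Touched
      0), Seg (Leaf 1) (Leaf 1), Seg Free Free, Seg Free (Touched 1)], -7, -3)), ([[Pick 4, Flip, Pick 4, Pick
      1, Join, New, Pick 1, Join, Pick 2, Join, Pick 2, Join, Pick 1, Join]], [Pick 1, Pick 1, Pick 4, Pick 4,
      Pick 4], ([Pnt (Touched 0), Seg (Leaf 1) (Leaf 1), Seg Free (Touched 1), Pnt (Paired 2), Pnt (Paired
      2)], -13, -5))),
    (([Seg (Leaf 0) (Leaf 0), Seg (Touched 0) (Touched 1)], -6, -2), [New, New], 2, ([[Pick 1, Pick 1, Join,
      Pick 1, Flip, Pick 1, Join]], [Pick 2, Pick 1, Pick 2], ([Seg (Leaf 0) (Leaf 0), Seg Free Free, Seg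
      (Touched 0) (Touched 1)], -5, -2)), ([[Pick 3, Pick 2, Pick 1, Join, Pick 2, Pick 1, Join, New, Pick 1,
      Join, Pick 1, Join]], [Pick 1, Pick 3, Flip, Join, Pick 1, Pick 2, Relabel [0, 0, 1]], ([Seg (Leaf 0)
      (Leaf 0), Pnt (Paired 1), Seg (Touched 0) (Paired 1)], -9, -3))),
    (([Seg Free (Touched 0), Pnt (Paired 1), Pnt (Paired 2), Seg (Paired 2) (Paired 1)], -9, -3), [Pick 3,
      New], 3, ([[Pick 3, Pick 1, Join, Pick 2, Pick 1, Join, Pick 1, Flip, Pick 1, Join]], [Pick 3, Pick 3,
      Pick 3, Pick 3, Unpair 2, Relabel [1, 0, 2]], ([Seg Free (Paired 0), Seg Free (Touched 1), Pnt (Paired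
      0), Pnt (Touched 2)], -7, -3)), ([[Pick 2, Pick 2, Flip, Pick 1, Join, Pick 2, Pick 1, Join, Pick 1,
      Pick 1, Join, New, Pick 1, Join, Pick 1, Pick 1, Join, New, Pick 1, Join]], [New, Pick 5, Join, Pick 3,
      Flip, Join, Pick 2, Pick 1, Pick 3, Pick 3, Relabel [2, 1, 0]], ([Pnt (Leaf 0), Pnt (Paired 1), Seg
      (Touched 2) Free, Seg (Touched 0) (Paired 1)], -11, -4))),
    (([Seg Free (Touched 0), Seg Free (Touched 1)], -1, -1), [New, Pick 1, Flip], 2, ([[Flip, Pick 1, Flip,
      Pick 1, Join]], [Pick 1, Pick 1, Flip], ([Seg Free (Touched 0), Seg Free (Touched 1)], -1, -1)), ([[Pick
      2, Flip, Pick 1, Join, Pick 1, Join]], [Pick 1, Pick 2, Relabel [2, 0, 1]], ([Seg Free (Touched 0), Pnt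
      (Paired 1), Seg (Touched 2) (Paired 1)], -6, -2))),
    (([Pnt (Touched 0), Seg (Leaf 0) (Leaf 0), Seg Free (Touched 1), Seg Free (Touched 1)], -10, -4), [New,
      New], 2, ([[Pick 2, Pick 1, Join, Pick 2, Pick 1, Join, Pick 1, Pick 1, Join, Pick 1, Flip, Pick 1,
      Join]], [Pick 4, Pick 4, Pick 2, Pick 4, Pick 4], ([Pnt (Touched 0), Seg (Leaf 0) (Leaf 0), Seg Free
      Free, Seg Free (Touched 1), Seg Free (Touched 1)], -8, -4)), ([[Pick 4, Pick 1, Pick 1, Join, Pick 2,
      Pick 1, Join, Pick 1, Pick 1, Join, Pick 2, Flip, Pick 1, Join, Pick 1, Pick 1, Join, New, Pick 1,
      Join]], [Pick 1, Pick 1, Pick 5, Pick 5, Pick 5, Pick 5], ([Pnt (Touched 0), Seg (Leaf 0) (Leaf 0), Seg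
      Free (Touched 1), Seg Free (Touched 1), Pnt (Paired 2), Pnt (Paired 2)], -15, -6))),
    (([Seg (Touched 0) (Touched 1), Seg (Leaf 0) (Leaf 0), Seg Free (Touched 2), Seg Free (Touched 2)], -10,
      -4), [New, New], 3, ([[Pick 2, Pick 1, Join, Pick 2, Pick 1, Join, Pick 1, Pick 1, Join, Pick 1, Flip,
      Pick 1, Join]], [Pick 4, Pick 4, Pick 2, Pick 4, Pick 4], ([Seg (Touched 0) (Touched 1), Seg (Leaf 0)
      (Leaf 0), Seg Free Free, Seg Free (Touched 2), Seg Free (Touched 2)], -8, -4)), ([[Pick 4, Pick 1, Pick
      1, Join, Pick 2, Pick 1, Join, Pick 1, Pick 1, Join, Pick 2, Flip, Pick 1, Join, Pick 1, Pick 1, Join,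
      New, Pick 1, Join]], [Pick 1, Pick 1, Pick 5, Pick 5, Pick 5, Pick 5], ([Seg (Touched 0) (Touched 1),
      Seg (Leaf 0) (Leaf 0), Seg Free (Touched 2), Seg Free (Touched 2), Pnt (Paired 3), Pnt (Paired 3)], -15,
      -6))),
    (([Pnt (Touched 0), Seg (Leaf 1) (Leaf 1), Seg Free Free, Seg Free (Touched 1)], -7, -3), [New, Pick 3],
      2, ([[Pick 2, Pick 1, Join, Pick 2, Pick 1, Join, Pick 1, Pick 1, Join]], [Pick 3, Pick 1, Pick 3, Pick
      3], ([Pnt (Touched 0), Seg (Leaf 1) (Leaf 1), Seg Free Free, Seg Free (Touched 1)], -7, -3)), ([[Pick 2,
      Pick 1, Join, Pick 1, Pick 1, Join, Pick 2, Flip, Pick 1, Join, Pick 1, Pick 1, Join, New, Pick 1,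
      Join]], [Pick 1, Pick 4, Join, Unpair 2, Pick 1, Pick 1, Pick 3, Pick 3, Relabel [0, 0, 1]], ([Pnt
      (Touched 0), Seg (Leaf 0) (Leaf 0), Seg Free (Touched 1), Seg Free (Touched 1)], -10, -4))),
    (([Pnt (Touched 0), Seg (Leaf 1) (Leaf 1), Seg Free (Touched 1), Pnt (Paired 2), Pnt (Paired 2)], -13,
      -5), [Pick 3, New], 3, ([[Pick 1, Pick 1, Join, Pick 3, Pick 1, Join, Pick 2, Flip, Pick 1, Join, Pick
      1, Pick 1, Join, New, Pick 1, Join]], [Pick 3, Flip, Pick 4, Join, Unpair 2, Pick 1, Pick 1, Flip, Pick
      3, Pick 3, Relabel [0, 0, 1]], ([Pnt (Touched 0), Seg (Leaf 0) (Leaf 0), Seg Free (Touched 1), Seg Free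
      (Touched 1)], -10, -4)), ([[Pick 4, Flip, Pick 4, Pick 1, Join, New, Pick 1, Join, Pick 1, Pick 1, Join,
      New, Pick 1, Join, Pick 3, Pick 1, Join, New, Pick 1, Join, Pick 2, Join, Pick 1, Join]], [New, Pick 6,
      Join, Pick 5, Flip, Join, New, Pick 5, Flip, Join, Flip, Pick 2, Join, Pick 1, Pick 2, Join, Flip, Pick
      1, Pick 2, Relabel [0, 1, 1]], ([Pnt (Touched 0), Seg (Leaf 1) (Leaf 1), Seg Free (Touched 1)], -8,
      -3))),
    (([Seg (Leaf 0) (Leaf 0), Seg Free Free, Seg (Touched 0) (Touched 1)], -5, -2), [New, Pick 2], 2, ([[Pick
      1, Pick 1, Join, Pick 1, Flip, Pick 1, Join]], [Pick 2, Pick 1, Pick 2], ([Seg (Leaf 0) (Leaf 0), Seg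
      Free Free, Seg (Touched 0) (Touched 1)], -5, -2)), ([[Pick 3, Pick 1, Flip, Pick 1, Join, Pick 2, Pick
      1, Join, New, Pick 1, Join, Pick 1, Join]], [Flip, Pick 3, Flip, Join, Unpair 2, Flip, Pick 2, Pick 2,
      Relabel [1, 1, 0]], ([Pnt (Touched 0), Seg (Leaf 1) (Leaf 1), Seg Free (Touched 1)], -8, -3))),
    (([Seg Free (Paired 0), Seg Free (Touched 1), Pnt (Paired 0), Pnt (Touched 2)], -7, -3), [Pick 3, New], 3,
      ([], [Pick 3, Pick 3, Pick 2, Pick 3, Relabel [0, 2, 1]], ([Seg Free (Paired 0), Seg Free (Touched 1),
      Seg Free (Touched 2), Pnt (Paired 0)], -5, -2)), ([[Pick 2, Pick 2, Pick 1, Join, Pick 3, Pick 1, Join,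
      Pick 2, Flip, Pick 1, Join, Pick 1, Pick 1, Join, New, Pick 1, Join]], [Pick 3, Flip, Pick 4, Join,
      Unpair 0, Pick 3, Pick 1, Flip, Pick 2, Widen, Pick 3, Relabel [1, 1, 0]], ([Pnt (Touched 0), Seg (Leaf
      0) (Leaf 0), Seg Free (Touched 1), Seg Free (Touched 1)], -10, -4))),
    (([Pnt (Leaf 0), Pnt (Paired 1), Seg (Touched 2) Free, Seg (Touched 0) (Paired 1)], -11, -4), [Pick 3,
      Flip, New], 3, ([[Pick 2, Pick 1, Join, Pick 2, Pick 1, Join, Pick 1, Pick 1, Join, New, Pick 1, Join]],
      [Unpair 1, Pick 3, Pick 1, Pick 2, Pick 3, Relabel [1, 0, 2]], ([Pnt (Touched 0), Pnt (Leaf 1), Seg Free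
      (Touched 1), Seg (Touched 2) Free], -10, -4)), ([[Pick 1, Pick 4, Pick 1, Join, Pick 1, Pick 1, Join,
      New, Pick 1, Join, Pick 1, Pick 1, Join, New, Pick 1, Join, Pick 1, Pick 1, Join, New, Pick 1, Join]],
      [New, Pick 4, Join, Pick 4, Join, New, Pick 4, Join, Pick 1, Join, Pick 2, Pick 1, Pick 2, Relabel [2,
      0, 1]], ([Pnt (Leaf 0), Seg (Touched 1) Free, Seg (Touched 0) (Touched 2)], -8, -3))),
    (([Seg Free (Touched 0), Pnt (Paired 1), Seg (Touched 2) (Paired 1)], -6, -2), [Pick 2, New], 3, ([],
      [Pick 2, Pick 2, Pick 2, Relabel [1, 0]], ([Seg Free (Paired 0), Seg Free (Touched 1), Pnt (Paired 0)],
      -4, -1)), ([[Pick 2, Pick 2, Flip, Pick 1, Join, Pick 2, Pick 1, Join, Pick 1, Pick 1, Join, New, Pick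
      1, Join]], [Pick 1, Pick 2, Flip, Pick 3, Pick 3, Relabel [2, 1, 0]], ([Pnt (Leaf 0), Pnt (Paired 1),
      Seg (Touched 2) Free, Seg (Touched 0) (Paired 1)], -11, -4))),
    (([Pnt (Touched 0), Seg (Leaf 0) (Leaf 0), Seg Free Free, Seg Free (Touched 1), Seg Free (Touched 1)], -8,
      -4), [New, Pick 3], 2, ([[Pick 2, Pick 1, Join, Pick 2, Pick 1, Join, Pick 1, Pick 1, Join, Pick 1,
      Flip, Pick 1, Join]], [Pick 4, Pick 4, Pick 2, Pick 4, Pick 4], ([Pnt (Touched 0), Seg (Leaf 0) (Leaf
      0), Seg Free Free, Seg Free (Touched 1), Seg Free (Touched 1)], -8, -4)), ([[Pick 4, Flip, Pick 1, Join,
      Pick 3, Pick 1, Join, Pick 3, Pick 1, Join, Pick 1, Pick 1, Join, Pick 1, Pick 1, Join]], [Pick 1, Pick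
      5, Pick 5, Pick 3, Pick 5, Pick 5, Relabel [0, 2, 1]], ([Pnt (Touched 0), Seg (Leaf 0) (Leaf 0), Seg
      Free (Paired 1), Seg Free (Touched 2), Seg Free (Touched 2), Pnt (Paired 1)], -13, -5))),
    (([Pnt (Touched 0), Seg (Leaf 0) (Leaf 0), Seg Free (Touched 1), Seg Free (Touched 1), Pnt (Paired 2), Pnt
      (Paired 2)], -15, -6), [Pick 4, New], 3, ([], [Pick 5, Pick 5, Pick 5, Pick 3, Pick 5, Pick 5, Relabel
      [0, 2, 1]], ([Pnt (Touched 0), Seg (Leaf 0) (Leaf 0), Seg Free (Paired 1), Seg Free (Touched 2), Seg
      Free (Touched 2), Pnt (Paired 1)], -13, -5)), ([[Pick 4, Pick 2, Pick 1, Join, Pick 2, Pick 1, Join,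
      Pick 3, Flip, Pick 1, Join, Pick 2, Pick 1, Join, New, Pick 1, Join, Pick 1, Pick 1, Join, New, Pick 1,
      Join, Pick 1, Pick 1, Join, New, Pick 1, Join]], [New, Pick 7, Join, Pick 6, Flip, Join, Pick 2, Pick 5,
      Join, New, Pick 5, Flip, Join, Pick 2, Join, Pick 1, Pick 2, Pick 3, Relabel [0, 2, 1]], ([Pnt (Touched
      0), Pnt (Leaf 1), Seg Free (Touched 1), Seg (Touched 2) Free], -10, -4))),
    (([Seg (Touched 0) (Touched 1), Seg (Leaf 0) (Leaf 0), Seg Free Free, Seg Free (Touched 2), Seg Free
      (Touched 2)], -8, -4), [New, Pick 3], 3, ([[Pick 2, Pick 1, Join, Pick 2, Pick 1, Join, Pick 1, Pick 1,
      Join, Pick 1, Flip, Pick 1, Join]], [Pick 4, Pick 4, Pick 2, Pick 4, Pick 4], ([Seg (Touched 0) (Touched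
      1), Seg (Leaf 0) (Leaf 0), Seg Free Free, Seg Free (Touched 2), Seg Free (Touched 2)], -8, -4)), ([[Pick
      2, Pick 1, Join, Pick 3, Flip, Pick 1, Join, Pick 2, Pick 1, Join, Pick 2, Pick 1, Join, Pick 1, Pick 1,
      Join]], [Pick 1, Pick 5, Pick 5, Pick 3, Pick 5, Pick 5, Relabel [0, 1, 3, 2]], ([Seg (Touched 0)
      (Touched 1), Seg (Leaf 0) (Leaf 0), Seg Free (Paired 2), Seg Free (Touched 3), Seg Free (Touched 3), Pnt
      (Paired 2)], -13, -5))),
    (([Seg (Touched 0) (Touched 1), Seg (Leaf 0) (Leaf 0), Seg Free (Touched 2), Seg Free (Touched 2), Pnt
      (Paired 3), Pnt (Paired 3)], -15, -6), [Pick 4, New], 4, ([], [Pick 5, Pick 5, Pick 5, Pick 3, Pick 5,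
      Pick 5, Relabel [0, 1, 3, 2]], ([Seg (Touched 0) (Touched 1), Seg (Leaf 0) (Leaf 0), Seg Free (Paired
      2), Seg Free (Touched 3), Seg Free (Touched 3), Pnt (Paired 2)], -13, -5)), ([[Pick 4, Pick 2, Pick 1,
      Join, Pick 2, Pick 1, Join, Pick 3, Flip, Pick 1, Join, Pick 2, Pick 1, Join, New, Pick 1, Join, Pick 1,
      Pick 1, Join, New, Pick 1, Join, Pick 1, Pick 1, Join, New, Pick 1, Join]], [New, Pick 7, Join, Pick 6,
      Flip, Join, Pick 2, Pick 5, Join, New, Pick 3, Join, Pick 2, Join, Pick 1, Pick 1, Flip, Pick 3, Pick 3,
      Relabel [0, 1, 2, 2]], ([Seg (Touched 0) (Touched 1), Seg (Leaf 0) (Leaf 0), Seg Free (Touched 2), Seg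
      Free (Touched 2)], -10, -4))),
    (([Seg Free (Paired 0), Seg Free (Touched 1), Seg Free (Touched 2), Pnt (Paired 0)], -5, -2), [Pick 3,
      Pick 1, Flip], 3, ([[Pick 1, Pick 1, Pick 1, Join, Pick 1, Flip, Pick 1, Join]], [Flip, Pick 2, Join,
      Pick 1, Pick 1, Unpair 0], ([Seg Free (Touched 0), Seg Free (Touched 1)], -1, -1)), ([[Pick 2, Pick 2,
      Pick 1, Join, Pick 2, Flip, Pick 1, Join, Pick 1, Pick 1, Join, New, Pick 1, Join]], [Pick 3, Pick 3,
      Pick 2, Pick 3, Relabel [0, 1, 1]], ([Pnt (Touched 0), Seg (Leaf 0) (Leaf 0), Seg Free (Touched 1), Seg
      Free (Touched 1)], -10, -4))),
    (([Pnt (Touched 0), Pnt (Leaf 1), Seg Free (Touched 1), Seg (Touched 2) Free], -10, -4), [New, New], 3,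
      ([[Pick 2, Pick 1, Join, Pick 2, Pick 1, Join, Pick 1, Pick 1, Join, Pick 1, Pick 1, Join]], [Pick 4,
      Pick 4, Pick 2, Pick 4, Pick 4], ([Pnt (Touched 0), Pnt (Leaf 1), Seg Free Free, Seg Free (Touched 1),
      Seg (Touched 2) Free], -8, -4)), ([[Pick 4, Pick 1, Pick 1, Join, Pick 2, Pick 1, Join, Pick 1, Pick 1,
      Join, Pick 2, Pick 1, Join, Pick 1, Pick 1, Join, New, Pick 1, Join]], [Pick 5, Pick 2, Pick 2, Pick 5,
      Pick 5, Pick 5, Relabel [0, 1, 3, 2]], ([Pnt (Touched 0), Pnt (Leaf 1), Seg Free (Touched 1), Pnt
      (Paired 2), Pnt (Paired 2), Seg (Touched 3) Free], -15, -6))),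
    (([Pnt (Leaf 0), Seg (Touched 1) Free, Seg (Touched 0) (Touched 2)], -8, -3), [New, New], 3, ([[Pick 1,
      Pick 1, Join, Pick 1, Flip, Pick 1, Join, Pick 1, Pick 1, Join]], [Pick 3, Pick 3, Pick 2, Pick 3],
      ([Pnt (Leaf 0), Seg Free Free, Seg (Touched 1) Free, Seg (Touched 0) (Touched 2)], -7, -3)), ([[Pick 4,
      Pick 2, Pick 1, Join, Pick 3, Pick 1, Join, Pick 2, Pick 1, Join, New, Pick 1, Join, Pick 1, Join]],
      [Pick 1, Pick 4, Flip, Join, Pick 3, Pick 2, Pick 3, Relabel [0, 2, 0, 1]], ([Pnt (Leaf 0), Pnt (Paired
      1), Seg (Touched 2) Free, Seg (Touched 0) (Paired 1)], -11, -4))),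
    (([Pnt (Touched 0), Seg (Leaf 0) (Leaf 0), Seg Free (Paired 1), Seg Free (Touched 2), Seg Free (Touched
      2), Pnt (Paired 1)], -13, -5), [Pick 5, New], 3, ([[Pick 1, Pick 1, Join, Pick 3, Flip, Pick 1, Join,
      Pick 1, Pick 1, Join, Pick 1, Pick 1, Join, Pick 1, Flip, Pick 1, Join]], [Pick 5, Pick 5, Pick 5, Pick
      3, Pick 5, Pick 5], ([Pnt (Touched 0), Seg (Leaf 0) (Leaf 0), Seg Free (Paired 1), Seg Free (Paired 1),
      Seg Free (Touched 2), Seg Free (Touched 2)], -11, -5)), ([[Pick 4, Pick 5, Pick 1, Join, Pick 2, Pick 1,
      Join, Pick 2, Pick 1, Join, Pick 3, Flip, Pick 1, Join, Pick 2, Pick 1, Join, New, Pick 1, Join, Pick 1,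
      Pick 1, Join, New, Pick 1, Join]], [Pick 4, Flip, Pick 6, Flip, Join, Pick 2, Pick 5, Join, New, Pick 5,
      Flip, Join, Pick 2, Join, Pick 1, Pick 2, Pick 3], ([Pnt (Touched 0), Pnt (Leaf 1), Seg Free (Touched
      1), Seg (Touched 2) Free], -10, -4))),
    (([Seg (Touched 0) (Touched 1), Seg (Leaf 0) (Leaf 0), Seg Free (Paired 2), Seg Free (Touched 3), Seg Free
      (Touched 3), Pnt (Paired 2)], -13, -5), [Pick 5, New], 4, ([[Pick 1, Pick 1, Join, Pick 3, Flip, Pick 1,
      Join, Pick 1, Pick 1, Join, Pick 1, Pick 1, Join, Pick 1, Flip, Pick 1, Join]], [Pick 5, Pick 5, Pick 5,
      Pick 3, Pick 5, Pick 5], ([Seg (Touched 0) (Touched 1), Seg (Leaf 0) (Leaf 0), Seg Free (Paired 2), Seg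
      Free (Paired 2), Seg Free (Touched 3), Seg Free (Touched 3)], -11, -5)), ([[Pick 4, Pick 5, Pick 1,
      Join, Pick 2, Pick 1, Join, Pick 2, Pick 1, Join, Pick 3, Flip, Pick 1, Join, Pick 2, Pick 1, Join, New,
      Pick 1, Join, Pick 1, Pick 1, Join, New, Pick 1, Join]], [Pick 4, Flip, Pick 6, Flip, Join, Pick 2, Pick
      5, Join, New, Pick 3, Join, Pick 2, Join, Pick 1, Pick 1, Flip, Pick 3, Pick 3, Relabel [0, 1, 2, 2]],
      ([Seg (Touched 0) (Touched 1), Seg (Leaf 0) (Leaf 0), Seg Free (Touched 2), Seg Free (Touched 2)], -10,
      -4))),
    (([Pnt (Touched 0), Pnt (Leaf 1), Seg Free Free, Seg Free (Touched 1), Seg (Touched 2) Free], -8, -4),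
      [New, Pick 3], 3, ([[Pick 2, Pick 1, Join, Pick 2, Pick 1, Join, Pick 1, Pick 1, Join, Pick 1, Pick 1,
      Join]], [Pick 4, Pick 4, Pick 2, Pick 4, Pick 4], ([Pnt (Touched 0), Pnt (Leaf 1), Seg Free Free, Seg
      Free (Touched 1), Seg (Touched 2) Free], -8, -4)), ([[Pick 4, Flip, Pick 1, Join, Pick 3, Pick 1, Join,
      Pick 3, Flip, Pick 1, Join, Pick 1, Pick 1, Join, Pick 1, Pick 1, Join]], [Pick 5, Pick 2, Pick 5, Pick
      3, Pick 5, Pick 5, Relabel [0, 1, 3, 2]], ([Pnt (Touched 0), Pnt (Leaf 1), Seg Free (Paired 2), Seg Free
      (Touched 1), Pnt (Paired 2), Seg (Touched 3) Free], -13, -5))),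
    (([Pnt (Touched 0), Pnt (Leaf 1), Seg Free (Touched 1), Pnt (Paired 2), Pnt (Paired 2), Seg (Touched 3)
      Free], -15, -6), [Pick 3, New], 4, ([], [Pick 5, Pick 5, Pick 5, Pick 3, Pick 5, Pick 5], ([Pnt (Touched
      0), Pnt (Leaf 1), Seg Free (Paired 2), Seg Free (Touched 1), Pnt (Paired 2), Seg (Touched 3) Free], -13,
      -5)), ([[Pick 4, Pick 2, Pick 1, Join, Pick 2, Pick 1, Join, Pick 4, Pick 1, Join, Pick 1, Pick 1, Join,
      New, Pick 1, Join, Pick 1, Pick 1, Join, New, Pick 1, Join, Pick 1, Pick 1, Join, New, Pick 1, Join]],
      [New, Pick 6, Join, Pick 6, Join, Pick 2, Pick 5, Join, New, Pick 5, Join, Pick 2, Join, Pick 1, Pick 2,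
      Pick 3, Relabel [0, 1, 1, 2]], ([Pnt (Touched 0), Pnt (Leaf 1), Seg Free (Touched 1), Seg (Touched 2)
      Free], -10, -4))),
    (([Pnt (Leaf 0), Seg Free Free, Seg (Touched 1) Free, Seg (Touched 0) (Touched 2)], -7, -3), [New, Pick
      2], 3, ([[Pick 1, Pick 1, Join, Pick 1, Flip, Pick 1, Join, Pick 1, Pick 1, Join]], [Pick 3, Pick 3,
      Pick 2, Pick 3], ([Pnt (Leaf 0), Seg Free Free, Seg (Touched 1) Free, Seg (Touched 0) (Touched 2)], -7,
      -3)), ([[Pick 4, Pick 1, Join, Pick 1, Pick 1, Join, Pick 2, Pick 1, Join, Pick 1, Pick 1, Join, New,
      Pick 1, Join]], [Flip, Pick 4, Flip, Join, Unpair 3, Pick 3, Flip, Pick 1, Flip, Pick 3, Widen, Pick 3,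
      Relabel [0, 1, 1, 0]], ([Pnt (Touched 0), Seg (Leaf 0) (Leaf 0), Seg Free (Touched 1), Seg Free (Touched
      1)], -10, -4))),
    (([Pnt (Touched 0), Seg (Leaf 0) (Leaf 0), Seg Free (Paired 1), Seg Free (Paired 1), Seg Free (Touched 2),
      Seg Free (Touched 2)], -11, -5), [Pick 4, Flip, New], 3, ([], [Pick 5, Pick 5, Pick 5, Pick 3, Pick 5,
      Pick 5], ([Pnt (Touched 0), Seg (Leaf 0) (Leaf 0), Seg Free Free, Seg Free (Paired 1), Seg Free (Paired
      1), Seg Free (Touched 2)], -9, -4)), ([[Pick 1, Flip, Pick 2, Pick 1, Join, Pick 3, Flip, Pick 1, Join,
      Pick 2, Pick 1, Join, Pick 2, Pick 1, Join, Pick 2, Flip, Pick 1, Join, Pick 1, Pick 1, Join, New, Pick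
      1, Join]], [Pick 5, Flip, Pick 6, Join, Pick 4, Flip, Pick 5, Flip, Join, Flip, Pick 1, Flip, Join,
      Flip, Pick 2, Flip, Pick 2, Pick 3, Unpair 1, Relabel [0, 2, 1]], ([Pnt (Touched 0), Pnt (Leaf 1), Seg
      Free (Touched 1), Seg (Touched 2) Free], -10, -4))),
    (([Seg (Touched 0) (Touched 1), Seg (Leaf 0) (Leaf 0), Seg Free (Paired 2), Seg Free (Paired 2), Seg Free
      (Touched 3), Seg Free (Touched 3)], -11, -5), [Pick 4, Flip, New], 4, ([], [Pick 5, Pick 5, Pick 5, Pick
      3, Pick 5, Pick 5], ([Seg (Touched 0) (Touched 1), Seg (Leaf 0) (Leaf 0), Seg Free Free, Seg Free
      (Paired 2), Seg Free (Paired 2), Seg Free (Touched 3)], -9, -4)), ([[Pick 1, Flip, Pick 2, Pick 1, Join,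
      Pick 3, Flip, Pick 1, Join, Pick 2, Pick 1, Join, Pick 2, Pick 1, Join, Pick 2, Flip, Pick 1, Join, Pick
      1, Pick 1, Join, New, Pick 1, Join]], [Pick 5, Flip, Pick 6, Join, Pick 1, Pick 5, Flip, Join, Flip,
      Pick 1, Flip, Join, Pick 1, Flip, Pick 1, Pick 3, Pick 3, Unpair 2, Relabel [0, 1, 2, 2]], ([Seg
      (Touched 0) (Touched 1), Seg (Leaf 0) (Leaf 0), Seg Free (Touched 2), Seg Free (Touched 2)], -10, -4))),
    (([Pnt (Touched 0), Pnt (Leaf 1), Seg Free (Paired 2), Seg Free (Touched 1), Pnt (Paired 2), Seg (Touched
      3) Free], -13, -5), [Pick 4, New], 4, ([[Pick 1, Pick 1, Join, Pick 2, Flip, Pick 1, Join, Pick 1, Pick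
      1, Join, Pick 1, Pick 1, Join, Pick 1, Pick 1, Join]], [Pick 5, Pick 5, Pick 5, Pick 3, Pick 5, Pick 5],
      ([Pnt (Touched 0), Pnt (Leaf 1), Seg Free (Paired 2), Seg Free (Paired 2), Seg Free (Touched 1), Seg
      (Touched 3) Free], -11, -5)), ([[Pick 4, Pick 5, Pick 1, Join, Pick 2, Pick 1, Join, Pick 2, Pick 1,
      Join, Pick 3, Pick 1, Join, Pick 1, Pick 1, Join, New, Pick 1, Join, Pick 1, Pick 1, Join, New, Pick 1,
      Join]], [Pick 4, Flip, Pick 6, Join, Pick 2, Pick 5, Join, New, Pick 5, Join, Pick 2, Join, Pick 1, Pick
      2, Pick 3, Relabel [0, 1, 1, 2]], ([Pnt (Touched 0), Pnt (Leaf 1), Seg Free (Touched 1), Seg (Touched 2)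
      Free], -10, -4))),
    (([Pnt (Touched 0), Seg (Leaf 0) (Leaf 0), Seg Free Free, Seg Free (Paired 1), Seg Free (Paired 1), Seg
      Free (Touched 2)], -9, -4), [Pick 3, Flip, Pick 3], 3, ([[Pick 2, Pick 1, Join, Pick 2, Pick 1, Join,
      Pick 1, Pick 1, Join, Pick 1, Flip, Pick 1, Join]], [Pick 4, Pick 4, Pick 2, Pick 4, Pick 4, Unpair 1,
      Relabel [0, 1, 1]], ([Pnt (Touched 0), Seg (Leaf 0) (Leaf 0), Seg Free Free, Seg Free (Touched 1), Seg
      Free (Touched 1)], -8, -4)), ([[Pick 1, Flip, Pick 1, Join, Pick 1, Pick 1, Join, Pick 3, Flip, Pick 1,
      Join, Pick 1, Pick 1, Join, Pick 1, Pick 1, Join, New, Pick 1, Join]], [Pick 4, Flip, Pick 5, Flip,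
      Join, Pick 1, Flip, Pick 2, Join, Pick 1, Flip, Pick 1, Flip, Pick 3, Pick 3, Relabel [0, 1, 1]], ([Pnt
      (Touched 0), Seg (Leaf 0) (Leaf 0), Seg Free (Touched 1), Seg Free (Touched 1)], -10, -4))),
    (([Seg (Touched 0) (Touched 1), Seg (Leaf 0) (Leaf 0), Seg Free Free, Seg Free (Paired 2), Seg Free
      (Paired 2), Seg Free (Touched 3)], -9, -4), [Pick 3, Flip, Pick 3], 4, ([[Pick 2, Pick 1, Join, Pick 2,
      Pick 1, Join, Pick 1, Pick 1, Join, Pick 1, Flip, Pick 1, Join]], [Pick 4, Pick 4, Pick 2, Pick 4, Pick
      4, Unpair 2, Relabel [0, 1, 2, 2]], ([Seg (Touched 0) (Touched 1), Seg (Leaf 0) (Leaf 0), Seg Free Free,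
      Seg Free (Touched 2), Seg Free (Touched 2)], -8, -4)), ([[Pick 1, Flip, Pick 1, Join, Pick 1, Pick 1,
      Join, Pick 3, Flip, Pick 1, Join, Pick 1, Pick 1, Join, Pick 1, Pick 1, Join, New, Pick 1, Join]], [Pick
      4, Flip, Pick 5, Flip, Join, Pick 1, Flip, Pick 2, Join, Pick 1, Flip, Pick 1, Flip, Pick 3, Pick 3,
      Relabel [0, 1, 2, 2]], ([Seg (Touched 0) (Touched 1), Seg (Leaf 0) (Leaf 0), Seg Free (Touched 2), Seg
      Free (Touched 2)], -10, -4))),
    (([Pnt (Touched 0), Pnt (Leaf 1), Seg Free (Paired 2), Seg Free (Paired 2), Seg Free (Touched 1), Seg
      (Touched 3) Free], -11, -5), [Pick 4, Flip, New], 4, ([], [Pick 5, Flip, Pick 5, Pick 5, Pick 3, Pick 5,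
      Widen, Pick 5, Relabel [0, 0, 1, 2]], ([Pnt (Touched 0), Seg (Leaf 0) (Leaf 0), Seg Free Free, Seg Free
      (Paired 1), Seg Free (Paired 1), Seg Free (Touched 2)], -9, -4)), ([[Pick 1, Flip, Pick 2, Pick 1, Join,
      Pick 3, Flip, Pick 1, Join, Pick 1, Pick 1, Join, Pick 2, Pick 1, Join, Pick 2, Pick 1, Join, Pick 1,
      Pick 1, Join, New, Pick 1, Join]], [Pick 5, Flip, Pick 6, Flip, Join, Pick 4, Pick 5, Flip, Join, Flip,
      Pick 1, Flip, Join, Flip, Pick 2, Flip, Pick 2, Pick 3, Unpair 2], ([Pnt (Touched 0), Pnt (Leaf 1), Seg
      Free (Touched 1), Seg (Touched 2) Free], -10, -4)))]"

text \<open>The case analysis of the upper bound: for each entry and either answer, the kinds after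
  the round, the value and the length bound are recomputed.\<close>

lemma check_strategy: "list_all check_node strategy"
  by code_simp

text \<open>Entries may lead back to themselves, as \<open>([Seg Free Free], 3, 0)\<close> does
  after a blue answer. Closure of the table together with the bound on the number of rounds takes
  the place of an order on the entries.\<close>

lemma closed_strategy:
  "list_all (\<lambda>(_, _, _, (_, _, B), (_, _, R)).
     B \<in> set (map fst strategy) \<and> R \<in> set (map fst strategy)) strategy"
  by code_simp

lemma start_strategy: "fst (hd strategy) = ([], 0, -2)" "strategy \<noteq> []"
  by (simp_all add: strategy_def)

section \<open>The value of the online Ramsey number\<close>

lemma wins_path_Nil:
  assumes "l \<ge> 3"
  shows "wins_path l []"
proof (rule check_sound)
  show "check_node n" if "n \<in> set strategy" for n
    using check_strategy that by (simp add: list_all_iff)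
  show "{B, R} \<subseteq> fst ` set strategy" if "(q, as, i, (cB, aB, B), (cR, aR, R)) \<in> set strategy"
    for q as i cB aB B cR aR R
    using closed_strategy that by (fastforce simp: list_all_iff)
  show "([], 0, -2) \<in> fst ` set strategy"
    using start_strategy by (metis hd_in_set image_eqI)
  have "realizes [] (\<lambda>_. 0) []" by (rule realizesI) auto
  from realizedI[OF this] show "realized [] [] 0" by (simp add: edge_count_def)
  \<comment> \<open>Without any edge, \<open>d = -2\<close> says 0 \<le> l - 3; this is where l
    \<ge> 3 enters the upper bound.\<close>
  show "admissible l [] 0 0 (-2)" using assms by (simp add: admissible_def)
qed

text \<open>Here (7 l + 2) / 5 = l + (2 l + 2) / 5, and n / 5 rounded up is
  \<open>(n + 4) div 5\<close>.\<close>

lemma ceiling_bound: "nat \<lceil>(7 * real l + 2) / 5\<rceil> = l + (2 * l + 6) div 5"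
proof -
  define q where "q = (2 * l + 6) div 5"
  have "5 * q \<le> 2 * l + 6" "2 * l + 2 \<le> 5 * q" unfolding q_def by linarith+
  then have "5 * real q \<le> 2 * real l + 6" "2 * real l + 2 \<le> 5 * real q" by linarith+
  then have "\<lceil>(7 * real l + 2) / 5\<rceil> = int (l + q)"
    by (intro ceiling_unique) (simp_all add: field_simps)
  then show ?thesis by (simp add: q_def)
qed

theorem theorem1p3:
  fixes l :: nat
  assumes "l \<ge> 3"
  shows "online_ramsey (path_graph 4) (path_graph (l + 1)) = enat (nat \<lceil>(7 * real l + 2) / 5\<rceil>)"
  unfolding ceiling_bound online_ramsey_def
proof (rule antisym)
  show "Inf (enat ` {N. builder_wins_within (path_graph 4) (path_graph (l + 1)) N}) \<le> enat (l + (2 * l + 6) div 5)"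
    using wins_imp_builder_wins_within[OF wins_path_Nil[OF assms]] by (intro Inf_lower) blast
  show "enat (l + (2 * l + 6) div 5) \<le> Inf (enat ` {N. builder_wins_within (path_graph 4) (path_graph (l + 1)) N})"
    using builder_wins_within_lower assms by (intro Inf_greatest) auto
qed

end
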